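(* Let $A=kQ/I$ be an algebra such that (1) there is a reduction system $\mathcal R=\{(s_i,f_i)\}_i$ for $I$ satisfying $(\lozenge)$ with $s_i$ and $f_i$ homogeneous of length $N\ge2$ for all $i$; (2) for all $n\in\mathbb N$, the length of the elements of $\mathcal A_n$ is strictly smaller than the length of the elements of $\mathcal A_{n+1}$. Let $(A\otimes_E k\mathcal A_\bullet\otimes_E A,d_\bullet)$ be a resolution of $A$ as $A$-bimodule (with $d_{-1}=\delta_{-1}$, $d_0=\delta_0$, and $A$-bimodule maps $d_i:A\otimes_E k\mathcal A_i\otimes_E A\to A\otimes_E k\mathcal A_{i-1}\otimes_E A$ for all $i\ge1$) such that $d_{i-1}\circ d_i=0$ and $(d_i-\delta_i)(1\otimes q\otimes1)\in\langle\overline{\mathcal L}_{i-1}^{\prec}(q)\rangle_k$ for all $i\ge1$ and all $q\in\mathcal A_i$. Then this resolution is minimal.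
   Context: Let $k$ be a field, $Q$ a quiver with finitely many vertices, $Q_n$ the set of paths of length $n$, $Q_{\ge n}=\bigcup_{i\ge n}Q_i$, $E=kQ_0$. Let $I$ be a two-sided ideal of $kQ$, $A=kQ/I$, $\pi:kQ\to A$ the projection; assume $\pi(Q_0\cup Q_1)$ is linearly independent. A path $p$ is a divisor of a path $q$ if $q=apb$ for paths $a,b$; it is a left divisor if moreover $a$ is a vertex, and a right divisor if $b$ is a vertex. An element $f\in kQ$ is parallel to a path $s$ if all paths in the support of $f$ have the same source and target as $s$. $p\in x$ means that the path $p$ is in the support of $x\in kQ$. $\langle X\rangle_R$ denotes the $R$-linear span of $X$. Reduction systems. A reduction system is a set $\mathcal R=\{(s_i,f_i)\}_{i\in\Gamma}$ with $s_i\in Q_{\ge0}$, $f_i\in kQ$ parallel to $s_i$, $f_i\ne s_i$, and $s_i$ not dividing $s_j$ for $i\neq j$. For $(s,f)\in\mathcal R$ and paths $a,c$ with $asc\ne0$ in $kQ$, the basic reduction $r_{a,s,c}:kQ\to kQ$ is the linear map with $r_{a,s,c}(asc)=afc$ and $r_{a,s,c}(q)=q$ for every path $q\ne asc$. A reduction $r=(r_n,\dots,r_1)$ is a finite sequence of basic reductions, acting on $kQ$ as $r_n\circ\cdots\circ r_1$. $x\in kQ$ is irreducible if $r(x)=x$ for all basic reductions $r$ (otherwise reducible). A path $p$ is reduction-finite if for every infinite sequence $(r_i)_{i\in\mathbb N}$ of basic reductions the sequence $r_n\circ\cdots\circ r_1(p)$ is eventually constant in $n$; it is reduction-unique if it is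 reduction-finite and $r(p)=r'(p)$ for any two reductions $r,r'$ with $r(p),r'(p)$ both irreducible. $\mathcal R$ satisfies $(\lozenge)$ for $I$ if $I$ is the two-sided ideal generated by $\{s-f\}_{(s,f)\in\mathcal R}$, every path is reduction-unique, and $f$ is irreducible for each $(s,f)\in\mathcal R$. Put $S=\{s:(s,f)\in\mathcal R\}$ and let $\mathcal B$ be the set of irreducible paths; $\{\pi(b):b\in\mathcal B\}$ is a basis of $A$. Ambiguities. $\mathcal A_{-1}=Q_0$, $\mathcal A_0=Q_1$, $\mathcal A_1=S$. For $n\ge2$, $\mathcal A_n$ is the set of $n$-ambiguities: paths $p=u_0u_1\cdots u_n$ with $u_0\in Q_1$, $u_1,\dots,u_n$ irreducible paths, such that for all $0\le i<n$, $u_iu_{i+1}$ is reducible but $u_id$ is irreducible for each proper left divisor $d$ of $u_{i+1}$ (left factorization). It is a known fact that these are the same as the paths $p=v_n\cdots v_0$ with $v_0\in Q_1$, $v_1,\dots,v_n$ irreducible, such that for all $0\le i<n$, $v_{i+1}v_i$ is reducible but $dv_i$ is irreducible for each proper right divisor $d$ of $v_{i+1}$ (right factorization), and that the factorizations are unique. Maps. $\delta_{-1}:A\otimes_E k\mathcal A_{-1}\otimes_E A\cong A\otimes_E A\to A$ is multiplication. For $n\ge0$, $\delta_n:A\otimes_E k\mathcal A_n\otimes_E A\to A\otimes_E k\mathcal A_{n-1}\otimes_E A$ is the $A$-bimodule map given on $q\in\mathcal A_n$ as follows: if $n$ is even and $q=u_0\cdots u_n=v_n\cdots v_0$ are the left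 and right factorizations, $\delta_n(1\otimes q\otimes1)=\pi(v_n)\otimes v_{n-1}\cdots v_0\otimes 1-1\otimes u_0\cdots u_{n-1}\otimes\pi(u_n)$ (for $n=0$: $\delta_0(1\otimes\alpha\otimes1)=\pi(\alpha)\otimes1-1\otimes\pi(\alpha)$); if $n$ is odd, $\delta_n(1\otimes q\otimes1)=\sum\pi(a)\otimes p\otimes\pi(c)$, summed over all $p\in\mathcal A_{n-1}$ and paths $a,c$ with $apc=q$. Order. On $k^\times Q_{\ge0}:=\{\lambda p:\lambda\in k^\times,p\in Q_{\ge0}\}\cup\{0\}$ let $\preceq$ be the least reflexive and transitive relation such that $\lambda p\preceq\mu q$ whenever there is a reduction $r$ with $r(\mu q)=\lambda p+x$, $p\notin x$, and such that $0\preceq\lambda p$ always. Write $\prec$ for $\preceq$ and $\neq$. For $n\ge-1$, $\overline{\mathcal L}_n^{\prec}(\mu q)=\{\lambda\pi(b)\otimes p\otimes\pi(b'): b,b'\in\mathcal B,\ p\in\mathcal A_n,\ \lambda bpb'\prec\mu q\}\subseteq A\otimes_E k\mathcal A_n\otimes_E A.$ Homogeneity and minimality. An element of $kQ$ is homogeneous of length $N$ if it is a linear combination of paths of length $N$ ($0$ is allowed). Hypothesis (2) means that every element of $\mathcal A_n$ is strictly shorter than every element of $\mathcal A_{n+1}$. Under (1), $A$ is graded by path length; let $J=\pi(kQ_{\ge1})$ (span of classes of paths of length $\ge1$). The resolution is minimal if for every $n\ge0$ the image of $d_n$ is contained in the radical $J\cdot P_{n-1}+P_{n-1}\cdot J$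 of $P_{n-1}=A\otimes_E k\mathcal A_{n-1}\otimes_E A$. *)

theory Defs
  imports
    "Graph_Theory.Arc_Walk"
    "HOL-Algebra.QuotRing"
    "HOL-Algebra.Module"
    "HOL-Algebra.Free_Abelian_Groups"
begin

section \<open>Paths of a quiver and the path algebra\<close>

text \<open>
  A quiver is a \<^locale>\<open>wf_digraph\<close> (loops and multiple arrows allowed); only the vertex set is
  required to be finite. A path is a triple (source, list of arrows, target). Paths are read from
  left to right: in the product \<open>p q\<close> the target of \<open>p\<close> is the source of \<open>q\<close>. Passing to the
  opposite quiver turns one convention into the other.
\<close>

type_synonym ('v, 'a) path = "'v \<times> 'a list \<times> 'v"
type_synonym ('v, 'a, 'k) kq = "('v, 'a) path \<Rightarrow>\<^sub>0 'k"

definition psrc :: "('v, 'a) path \<Rightarrow> 'v" where "psrc p = fst p"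
definition parcs :: "('v, 'a) path \<Rightarrow> 'a list" where "parcs p = fst (snd p)"
definition ptgt :: "('v, 'a) path \<Rightarrow> 'v" where "ptgt p = snd (snd p)"
definition plen :: "('v, 'a) path \<Rightarrow> nat" where "plen p = length (parcs p)"

definition paths :: "('v, 'a) pre_digraph \<Rightarrow> ('v, 'a) path set" where
  "paths Q = {p. pre_digraph.awalk Q (psrc p) (parcs p) (ptgt p)}"

definition paths_eq :: "('v, 'a) pre_digraph \<Rightarrow> nat \<Rightarrow> ('v, 'a) path set" where
  "paths_eq Q n = {p \<in> paths Q. plen p = n}"

definition paths_ge :: "('v, 'a) pre_digraph \<Rightarrow> nat \<Rightarrow> ('v, 'a) path set" where
  "paths_ge Q n = (\<Union>i\<in>{n..}. paths_eq Q i)"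

text \<open>\<open>linked p q\<close> says that the product of \<open>p\<close> and \<open>q\<close> is nonzero in the path algebra; only then is
  \<open>pcat p q\<close> meaningful. Likewise \<open>pprod ps\<close> is the product of a nonempty list of successively
  linked paths.\<close>

definition linked :: "('v, 'a) path \<Rightarrow> ('v, 'a) path \<Rightarrow> bool" where
  "linked p q \<longleftrightarrow> ptgt p = psrc q"

definition pcat :: "('v, 'a) path \<Rightarrow> ('v, 'a) path \<Rightarrow> ('v, 'a) path" where
  "pcat p q = (psrc p, parcs p @ parcs q, ptgt q)"

definition pprod :: "('v, 'a) path list \<Rightarrow> ('v, 'a) path" where
  "pprod ps = (psrc (hd ps), concat (map parcs ps), ptgt (last ps))"

definition divisor :: "('v, 'a) pre_digraph \<Rightarrow> ('v, 'a) path \<Rightarrow> ('v, 'a) path \<Rightarrow> bool" where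
  "divisor Q p q \<longleftrightarrow>
    (\<exists>a\<in>paths Q. \<exists>b\<in>paths Q. linked a p \<and> linked p b \<and> q = pcat (pcat a p) b)"

definition left_divisor :: "('v, 'a) pre_digraph \<Rightarrow> ('v, 'a) path \<Rightarrow> ('v, 'a) path \<Rightarrow> bool" where
  "left_divisor Q p q \<longleftrightarrow>
    (\<exists>a\<in>paths_eq Q 0. \<exists>b\<in>paths Q. linked a p \<and> linked p b \<and> q = pcat (pcat a p) b)"

definition right_divisor :: "('v, 'a) pre_digraph \<Rightarrow> ('v, 'a) path \<Rightarrow> ('v, 'a) path \<Rightarrow> bool" where
  "right_divisor Q p q \<longleftrightarrow>
    (\<exists>a\<in>paths Q. \<exists>b\<in>paths_eq Q 0. linked a p \<and> linked p b \<and> q = pcat (pcat a p) b)"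

definition pmono :: "'k::field \<Rightarrow> ('v, 'a) path \<Rightarrow> ('v, 'a, 'k) kq" where
  "pmono c p = Poly_Mapping.single p c"

abbreviation pmono1 :: "('v, 'a) path \<Rightarrow> ('v, 'a, 'k::field) kq" where
  "pmono1 p \<equiv> pmono 1 p"

definition kq_mult :: "('v, 'a, 'k::field) kq \<Rightarrow> ('v, 'a, 'k) kq \<Rightarrow> ('v, 'a, 'k) kq" where
  "kq_mult x y = (\<Sum>p\<in>Poly_Mapping.keys x. \<Sum>q\<in>Poly_Mapping.keys y.
     if linked p q then pmono (Poly_Mapping.lookup x p * Poly_Mapping.lookup y q) (pcat p q) else 0)"

text \<open>The image of a scalar under the structure map of the path algebra.\<close>
definition kq_const :: "('v, 'a) pre_digraph \<Rightarrow> 'k::field \<Rightarrow> ('v, 'a, 'k) kq" where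
  "kq_const Q c = (\<Sum>v\<in>verts Q. pmono c (v, [], v))"

definition span_paths :: "('v, 'a) path set \<Rightarrow> ('v, 'a, 'k::field) kq set" where
  "span_paths X = {x. Poly_Mapping.keys x \<subseteq> X}"

definition path_algebra :: "('v, 'a) pre_digraph \<Rightarrow> ('v, 'a, 'k::field) kq ring" where
  "path_algebra Q =
    \<lparr>carrier = span_paths (paths Q), mult = kq_mult, one = kq_const Q 1, ring.zero = 0, ring.add = (+)\<rparr>"

lemma keys_pmono: "Poly_Mapping.keys (pmono c p) \<subseteq> {p}"
  by (simp add: pmono_def)

lemma pmono_add: "pmono (c + d) p = pmono c p + pmono d p"
  by (simp add: pmono_def single_add)

lemma pmono_0 [simp]: "pmono 0 p = 0"
  by (simp add: pmono_def)

lemma kq_mult_superset: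
  assumes "finite X" "Poly_Mapping.keys x \<subseteq> X" "finite Y" "Poly_Mapping.keys y \<subseteq> Y"
  shows "kq_mult x y = (\<Sum>p\<in>X. \<Sum>q\<in>Y.
     if linked p q then pmono (Poly_Mapping.lookup x p * Poly_Mapping.lookup y q) (pcat p q) else 0)"
    (is "_ = (\<Sum>p\<in>X. ?f p Y)")
proof -
  have 1: "?f p (Poly_Mapping.keys y) = ?f p Y" for p
  proof (rule sum.mono_neutral_left)
    show "\<forall>q\<in>Y - Poly_Mapping.keys y. (if linked p q
        then pmono (Poly_Mapping.lookup x p * Poly_Mapping.lookup y q) (pcat p q) else 0) = 0"
      by (simp add: in_keys_iff)
  qed (use assms in simp_all)
  have 2: "(\<Sum>p\<in>Poly_Mapping.keys x. ?f p Y) = (\<Sum>p\<in>X. ?f p Y)"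
  proof (rule sum.mono_neutral_left)
    show "\<forall>p\<in>X - Poly_Mapping.keys x. ?f p Y = 0"
      by (simp add: in_keys_iff cong: if_cong)
  qed (use assms in simp_all)
  show ?thesis
    unfolding kq_mult_def 1 2 ..
qed

lemma kq_mult_add_left: "kq_mult (x + y) z = kq_mult x z + kq_mult y z"
proof -
  let ?X = "Poly_Mapping.keys x \<union> Poly_Mapping.keys y"
  have e: "kq_mult w z = (\<Sum>p\<in>?X. \<Sum>q\<in>Poly_Mapping.keys z. if linked p q
      then pmono (Poly_Mapping.lookup w p * Poly_Mapping.lookup z q) (pcat p q) else 0)"
    if "Poly_Mapping.keys w \<subseteq> ?X" for w
    by (rule kq_mult_superset) (use that in simp_all)
  show ?thesis
    unfolding e[OF keys_add] e[OF Un_upper1] e[OF Un_upper2] sum.distrib[symmetric]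
    by (intro sum.cong refl) (simp add: lookup_add distrib_right pmono_add)
qed

lemma kq_mult_add_right: "kq_mult z (x + y) = kq_mult z x + kq_mult z y"
proof -
  let ?X = "Poly_Mapping.keys x \<union> Poly_Mapping.keys y"
  have e: "kq_mult z w = (\<Sum>p\<in>Poly_Mapping.keys z. \<Sum>q\<in>?X. if linked p q
      then pmono (Poly_Mapping.lookup z p * Poly_Mapping.lookup w q) (pcat p q) else 0)"
    if "Poly_Mapping.keys w \<subseteq> ?X" for w
    by (rule kq_mult_superset) (use that in simp_all)
  show ?thesis
    unfolding e[OF keys_add] e[OF Un_upper1] e[OF Un_upper2] sum.distrib[symmetric]
    by (intro sum.cong refl) (simp add: lookup_add distrib_left pmono_add)
qed

lemma kq_mult_0_left [simp]: "kq_mult 0 x = 0" and kq_mult_0_right [simp]: "kq_mult x 0 = 0"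
  by (simp_all add: kq_mult_def)

lemma kq_mult_sum_left: "kq_mult (\<Sum>i\<in>F. f i) z = (\<Sum>i\<in>F. kq_mult (f i) z)"
  by (induction F rule: infinite_finite_induct) (auto simp: kq_mult_add_left)

lemma kq_mult_sum_right: "kq_mult z (\<Sum>i\<in>F. f i) = (\<Sum>i\<in>F. kq_mult z (f i))"
  by (induction F rule: infinite_finite_induct) (auto simp: kq_mult_add_right)

lemma kq_mult_pmono:
  "kq_mult (pmono c p) (pmono d q) = (if linked p q then pmono (c * d) (pcat p q) else 0)"
  by (subst kq_mult_superset[where X = "{p}" and Y = "{q}"])
    (auto simp: keys_pmono pmono_def)

lemma sum_pmono: "x = (\<Sum>p\<in>Poly_Mapping.keys x. pmono (Poly_Mapping.lookup x p) p)"
  by (rule poly_mapping_eqI)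
    (auto simp: pmono_def lookup_sum lookup_single when_def in_keys_iff)

lemma linked_pcat [simp]:
  "linked (pcat p q) r \<longleftrightarrow> linked q r" "linked p (pcat q r) \<longleftrightarrow> linked p q"
  by (simp_all add: linked_def pcat_def psrc_def ptgt_def)

lemma pcat_assoc: "pcat (pcat p q) r = pcat p (pcat q r)"
  by (simp add: pcat_def psrc_def ptgt_def parcs_def)

lemma kq_mult_assoc: "kq_mult (kq_mult x y) z = kq_mult x (kq_mult y z)"
proof -
  have 1: "kq_mult (kq_mult (pmono a p) (pmono b q)) (pmono c r) =
      kq_mult (pmono a p) (kq_mult (pmono b q) (pmono c r))" for a p b q c r
    by (auto simp: kq_mult_pmono pcat_assoc mult.assoc)
  have 2: "kq_mult (kq_mult (pmono a p) (pmono b q)) z =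
      kq_mult (pmono a p) (kq_mult (pmono b q) z)" for a p b q
    by (subst (1 2) sum_pmono[of z]) (simp only: kq_mult_sum_right 1)
  have 3: "kq_mult (kq_mult (pmono a p) y) z = kq_mult (pmono a p) (kq_mult y z)" for a p
    by (subst (1 2) sum_pmono[of y]) (simp only: kq_mult_sum_right kq_mult_sum_left 2)
  show ?thesis
    by (subst (1 2) sum_pmono[of x]) (simp only: kq_mult_sum_left 3)
qed

lemma pcat_in_paths:
  assumes "wf_digraph Q" "p \<in> paths Q" "q \<in> paths Q" "linked p q"
  shows "pcat p q \<in> paths Q"
  using assms wf_digraph.awalk_appendI[OF assms(1), of "psrc p" "parcs p" "ptgt p" "parcs q" "ptgt q"]
  by (auto simp: paths_def linked_def pcat_def psrc_def ptgt_def parcs_def)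

lemma span_paths_add: "x \<in> span_paths X \<Longrightarrow> y \<in> span_paths X \<Longrightarrow> x + y \<in> span_paths X"
  using keys_add[of x y] by (auto simp: span_paths_def)

lemma span_paths_sum: "(\<And>i. i \<in> F \<Longrightarrow> f i \<in> span_paths X) \<Longrightarrow> (\<Sum>i\<in>F. f i) \<in> span_paths X"
proof (induction F rule: infinite_finite_induct)
  case (insert i F)
  then show ?case by (simp add: span_paths_add)
qed (simp_all add: span_paths_def)

lemma pmono_in_span: "p \<in> X \<Longrightarrow> pmono c p \<in> span_paths X"
  using keys_pmono[of c p] by (auto simp: span_paths_def)

lemma vertex_paths:
  assumes "wf_digraph Q" "v \<in> verts Q" shows "(v, [], v) \<in> paths Q"
  using wf_digraph.awalk_Nil_iff[OF assms(1)] assms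
  by (simp add: paths_def psrc_def ptgt_def parcs_def)

lemma psrc_ptgt_in_verts:
  assumes "wf_digraph Q" "p \<in> paths Q" shows "psrc p \<in> verts Q" "ptgt p \<in> verts Q"
  using assms(2) wf_digraph.awalk_last_in_verts[OF assms(1), of "psrc p" "parcs p" "ptgt p"]
  by (simp_all add: paths_def pre_digraph.awalk_def)

lemma kq_const_left:
  assumes "wf_digraph Q" "finite (verts Q)" "p \<in> paths Q"
  shows "kq_mult (kq_const Q c) (pmono d p) = pmono (c * d) p"
proof -
  have "kq_mult (kq_const Q c) (pmono d p) =
      (\<Sum>v\<in>verts Q. if v = psrc p then pmono (c * d) p else 0)"
    unfolding kq_const_def kq_mult_sum_left
    by (auto intro!: sum.cong simp: kq_mult_pmono linked_def pcat_def psrc_def ptgt_def parcs_def)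
  then show ?thesis using psrc_ptgt_in_verts[OF assms(1,3)] assms(2) by simp
qed

lemma kq_const_right:
  assumes "wf_digraph Q" "finite (verts Q)" "p \<in> paths Q"
  shows "kq_mult (pmono d p) (kq_const Q c) = pmono (c * d) p"
proof -
  have "kq_mult (pmono d p) (kq_const Q c) =
      (\<Sum>v\<in>verts Q. if v = ptgt p then pmono (c * d) p else 0)"
    unfolding kq_const_def kq_mult_sum_right
    by (auto intro!: sum.cong simp: kq_mult_pmono linked_def pcat_def psrc_def ptgt_def parcs_def
        mult.commute)
  then show ?thesis using psrc_ptgt_in_verts[OF assms(1,3)] assms(2) by simp
qed

lemma ring_path_algebra:
  assumes "wf_digraph Q" "finite (verts Q)"
  shows "ring (path_algebra Q :: ('v, 'a, 'k::field) kq ring)"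
proof (rule ringI)
  show "abelian_group (path_algebra Q :: ('v, 'a, 'k) kq ring)"
  proof (rule abelian_groupI)
    fix x :: "('v, 'a, 'k) kq" assume "x \<in> carrier (path_algebra Q)"
    then show "\<exists>y\<in>carrier (path_algebra Q). y \<oplus>\<^bsub>path_algebra Q\<^esub> x = \<zero>\<^bsub>path_algebra Q\<^esub>"
      by (intro bexI[of _ "- x"]) (auto simp: path_algebra_def span_paths_def)
  qed (simp_all add: path_algebra_def span_paths_add add.assoc add.commute,
      simp add: span_paths_def)
  have cl: "kq_mult x y \<in> span_paths (paths Q)"
    if "x \<in> span_paths (paths Q)" "y \<in> span_paths (paths Q)" for x y :: "('v, 'a, 'k) kq"
    unfolding kq_mult_def
  proof (intro span_paths_sum)
    fix p q assume "p \<in> Poly_Mapping.keys x" "q \<in> Poly_Mapping.keys y"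
    then have "p \<in> paths Q" "q \<in> paths Q" using that by (auto simp: span_paths_def)
    then show "(if linked p q
         then pmono (Poly_Mapping.lookup x p * Poly_Mapping.lookup y q) (pcat p q) else 0)
         \<in> span_paths (paths Q)"
      using pcat_in_paths[OF assms(1), of p q]
      by (cases "linked p q") (simp_all add: pmono_in_span, simp add: span_paths_def)
  qed
  have unit: "kq_mult (kq_const Q 1) x = x" "kq_mult x (kq_const Q 1) = x"
    if "x \<in> span_paths (paths Q)" for x :: "('v, 'a, 'k) kq"
  proof -
    have k: "\<And>p. p \<in> Poly_Mapping.keys x \<Longrightarrow> p \<in> paths Q" using that by (auto simp: span_paths_def)
    have "kq_mult (kq_const Q 1) (\<Sum>p\<in>Poly_Mapping.keys x. pmono (Poly_Mapping.lookup x p) p) =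
        (\<Sum>p\<in>Poly_Mapping.keys x. pmono (Poly_Mapping.lookup x p) p)"
      unfolding kq_mult_sum_right by (intro sum.cong refl) (simp add: kq_const_left assms k)
    then show "kq_mult (kq_const Q 1) x = x" by (simp only: sum_pmono[of x, symmetric])
    have "kq_mult (\<Sum>p\<in>Poly_Mapping.keys x. pmono (Poly_Mapping.lookup x p) p) (kq_const Q 1) =
        (\<Sum>p\<in>Poly_Mapping.keys x. pmono (Poly_Mapping.lookup x p) p)"
      unfolding kq_mult_sum_left by (intro sum.cong refl) (simp add: kq_const_right assms k)
    then show "kq_mult x (kq_const Q 1) = x" by (simp only: sum_pmono[of x, symmetric])
  qed
  have "kq_const Q 1 \<in> (span_paths (paths Q) :: ('v, 'a, 'k) kq set)"
    unfolding kq_const_def using vertex_paths[OF assms(1)]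
    by (intro span_paths_sum pmono_in_span) auto
  then show "Group.monoid (path_algebra Q :: ('v, 'a, 'k) kq ring)"
    by (intro monoidI) (simp_all add: path_algebra_def cl unit kq_mult_assoc)
qed (simp_all add: path_algebra_def kq_mult_add_left kq_mult_add_right)


section \<open>The algebra A = kQ/I\<close>

definition quot_alg :: "('v, 'a) pre_digraph \<Rightarrow> ('v, 'a, 'k::field) kq set \<Rightarrow> ('v, 'a, 'k) kq set ring"
  where "quot_alg Q I = path_algebra Q Quot I"

definition proj :: "('v, 'a) pre_digraph \<Rightarrow> ('v, 'a, 'k::field) kq set \<Rightarrow> ('v, 'a, 'k) kq
    \<Rightarrow> ('v, 'a, 'k) kq set" where
  "proj Q I x = I +>\<^bsub>path_algebra Q\<^esub> x"

text \<open>Linear independence over \<open>k\<close> of the family of classes of the paths in \<open>X\<close>; in particular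
  distinct paths have distinct classes. The scalar \<open>c\<close> acts on \<open>A\<close> through \<open>\<pi> (c 1)\<close>.\<close>
definition lin_indep_classes ::
    "('v, 'a) pre_digraph \<Rightarrow> ('v, 'a, 'k::field) kq set \<Rightarrow> ('v, 'a) path set \<Rightarrow> bool" where
  "lin_indep_classes Q I X \<longleftrightarrow> (\<forall>F (c :: ('v, 'a) path \<Rightarrow> 'k). finite F \<and> F \<subseteq> X \<and>
     finsum (quot_alg Q I)
       (\<lambda>p. proj Q I (kq_const Q (c p)) \<otimes>\<^bsub>quot_alg Q I\<^esub> proj Q I (pmono1 p)) F
       = \<zero>\<^bsub>quot_alg Q I\<^esub>
     \<longrightarrow> (\<forall>p\<in>F. c p = 0))"


section \<open>Reduction systems\<close>

type_synonym ('v, 'a, 'k) redsys = "(('v, 'a) path \<times> ('v, 'a, 'k) kq) set"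

definition parallel :: "('v, 'a, 'k::field) kq \<Rightarrow> ('v, 'a) path \<Rightarrow> bool" where
  "parallel f s \<longleftrightarrow> (\<forall>p\<in>Poly_Mapping.keys f. psrc p = psrc s \<and> ptgt p = ptgt s)"

definition reduction_system :: "('v, 'a) pre_digraph \<Rightarrow> ('v, 'a, 'k::field) redsys \<Rightarrow> bool" where
  "reduction_system Q R \<longleftrightarrow>
    (\<forall>(s, f)\<in>R. s \<in> paths Q \<and> f \<in> carrier (path_algebra Q) \<and> parallel f s \<and> f \<noteq> pmono1 s) \<and>
    (\<forall>(s, f)\<in>R. \<forall>(s', f')\<in>R. (s, f) \<noteq> (s', f') \<longrightarrow> \<not> divisor Q s s')"

definition basic_reduction :: "('v, 'a) path \<Rightarrow> ('v, 'a) path \<Rightarrow> ('v, 'a, 'k::field) kq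
    \<Rightarrow> ('v, 'a) path \<Rightarrow> ('v, 'a, 'k) kq \<Rightarrow> ('v, 'a, 'k) kq" where
  "basic_reduction a s f c x = (\<Sum>q\<in>Poly_Mapping.keys x.
     if q = pcat (pcat a s) c
     then kq_mult (kq_mult (pmono (Poly_Mapping.lookup x q) a) f) (pmono1 c)
     else pmono (Poly_Mapping.lookup x q) q)"

definition basic_reductions :: "('v, 'a) pre_digraph \<Rightarrow> ('v, 'a, 'k::field) redsys
    \<Rightarrow> (('v, 'a, 'k) kq \<Rightarrow> ('v, 'a, 'k) kq) set" where
  "basic_reductions Q R = {basic_reduction a s f c | a s f c.
     (s, f) \<in> R \<and> a \<in> paths Q \<and> c \<in> paths Q \<and> linked a s \<and> linked s c}"

definition reductions :: "('v, 'a) pre_digraph \<Rightarrow> ('v, 'a, 'k::field) redsys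
    \<Rightarrow> (('v, 'a, 'k) kq \<Rightarrow> ('v, 'a, 'k) kq) set" where
  "reductions Q R = {foldr (\<circ>) rs id | rs. set rs \<subseteq> basic_reductions Q R}"

definition irreducible_elt ::
    "('v, 'a) pre_digraph \<Rightarrow> ('v, 'a, 'k::field) redsys \<Rightarrow> ('v, 'a, 'k) kq \<Rightarrow> bool" where
  "irreducible_elt Q R x \<longleftrightarrow> (\<forall>r\<in>basic_reductions Q R. r x = x)"

abbreviation irred_path ::
    "('v, 'a) pre_digraph \<Rightarrow> ('v, 'a, 'k::field) redsys \<Rightarrow> ('v, 'a) path \<Rightarrow> bool" where
  "irred_path Q R p \<equiv> irreducible_elt Q R (pmono1 p)"

definition irr_paths ::
    "('v, 'a) pre_digraph \<Rightarrow> ('v, 'a, 'k::field) redsys \<Rightarrow> ('v, 'a) path set" where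
  "irr_paths Q R = {b \<in> paths Q. irred_path Q R b}"

text \<open>\<open>iterate r n x\<close> is the result of applying \<open>r 0\<close>, then \<open>r 1\<close>, ..., then \<open>r (n - 1)\<close> to \<open>x\<close>.\<close>
primrec iterate :: "(nat \<Rightarrow> 'x \<Rightarrow> 'x) \<Rightarrow> nat \<Rightarrow> 'x \<Rightarrow> 'x" where
  "iterate r 0 x = x"
| "iterate r (Suc n) x = r n (iterate r n x)"

definition reduction_finite ::
    "('v, 'a) pre_digraph \<Rightarrow> ('v, 'a, 'k::field) redsys \<Rightarrow> ('v, 'a) path \<Rightarrow> bool" where
  "reduction_finite Q R p \<longleftrightarrow> (\<forall>r. (\<forall>i. r i \<in> basic_reductions Q R) \<longrightarrow>
     (\<exists>m. \<forall>n\<ge>m. iterate r n (pmono1 p) = iterate r m (pmono1 p)))"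

definition reduction_unique ::
    "('v, 'a) pre_digraph \<Rightarrow> ('v, 'a, 'k::field) redsys \<Rightarrow> ('v, 'a) path \<Rightarrow> bool" where
  "reduction_unique Q R p \<longleftrightarrow> reduction_finite Q R p \<and>
     (\<forall>r\<in>reductions Q R. \<forall>r'\<in>reductions Q R.
        irreducible_elt Q R (r (pmono1 p)) \<and> irreducible_elt Q R (r' (pmono1 p))
        \<longrightarrow> r (pmono1 p) = r' (pmono1 p))"

definition diamond :: "('v, 'a) pre_digraph \<Rightarrow> ('v, 'a, 'k::field) kq set
    \<Rightarrow> ('v, 'a, 'k) redsys \<Rightarrow> bool" where
  "diamond Q I R \<longleftrightarrow>
     I = Idl\<^bsub>path_algebra Q\<^esub> {pmono1 s - f | s f. (s, f) \<in> R} \<and>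
     (\<forall>p\<in>paths Q. reduction_unique Q R p) \<and>
     (\<forall>(s, f)\<in>R. irreducible_elt Q R f)"


section \<open>Ambiguities\<close>

definition left_fact :: "('v, 'a) pre_digraph \<Rightarrow> ('v, 'a, 'k::field) redsys \<Rightarrow> nat
    \<Rightarrow> ('v, 'a) path list \<Rightarrow> ('v, 'a) path \<Rightarrow> bool" where
  "left_fact Q R n us q \<longleftrightarrow>
     length us = Suc n \<and> successively linked us \<and> q = pprod us \<and>
     us ! 0 \<in> paths_eq Q 1 \<and> (\<forall>i\<in>{1..n}. us ! i \<in> irr_paths Q R) \<and>
     (\<forall>i<n. \<not> irred_path Q R (pcat (us ! i) (us ! Suc i)) \<and>
        (\<forall>d\<in>paths Q. left_divisor Q d (us ! Suc i) \<and> d \<noteq> us ! Suc i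
           \<longrightarrow> irred_path Q R (pcat (us ! i) d)))"

text \<open>The list \<open>vs\<close> contains \<open>v\<^sub>0, \<dots>, v\<^sub>n\<close> in this order, so the path is the product of \<open>rev vs\<close>.\<close>
definition right_fact :: "('v, 'a) pre_digraph \<Rightarrow> ('v, 'a, 'k::field) redsys \<Rightarrow> nat
    \<Rightarrow> ('v, 'a) path list \<Rightarrow> ('v, 'a) path \<Rightarrow> bool" where
  "right_fact Q R n vs q \<longleftrightarrow>
     length vs = Suc n \<and> successively linked (rev vs) \<and> q = pprod (rev vs) \<and>
     vs ! 0 \<in> paths_eq Q 1 \<and> (\<forall>i\<in>{1..n}. vs ! i \<in> irr_paths Q R) \<and>
     (\<forall>i<n. \<not> irred_path Q R (pcat (vs ! Suc i) (vs ! i)) \<and>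
        (\<forall>d\<in>paths Q. right_divisor Q d (vs ! Suc i) \<and> d \<noteq> vs ! Suc i
           \<longrightarrow> irred_path Q R (pcat d (vs ! i))))"

definition amb :: "('v, 'a) pre_digraph \<Rightarrow> ('v, 'a, 'k::field) redsys \<Rightarrow> int \<Rightarrow> ('v, 'a) path set"
  where "amb Q R n =
    (if n = -1 then paths_eq Q 0
     else if n = 0 then paths_eq Q 1
     else if n = 1 then fst ` R
     else if n \<ge> 2 then {q. \<exists>us. left_fact Q R (nat n) us q}
     else {})"


section \<open>Bimodules and the tensor products\<close>

text \<open>The inherited field \<open>smult\<close> is the left action. The fields \<open>mult\<close> and \<open>one\<close> are irrelevant,
  as for \<^locale>\<open>module\<close>.\<close>
record ('r, 'm) bimodule = "('r, 'm) module" +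
  rsmult :: "'m \<Rightarrow> 'r \<Rightarrow> 'm"

definition regular_bimodule :: "'r ring \<Rightarrow> ('r, 'r) bimodule" where
  "regular_bimodule A = \<lparr>carrier = carrier A, mult = mult A, one = one A, ring.zero = ring.zero A,
     ring.add = ring.add A, smult = mult A, rsmult = mult A\<rparr>"

definition bimodule_hom ::
    "'r ring \<Rightarrow> ('r, 'm) bimodule \<Rightarrow> ('r, 'n) bimodule \<Rightarrow> ('m \<Rightarrow> 'n) set" where
  "bimodule_hom A M N = {h. h \<in> carrier M \<rightarrow> carrier N \<and>
     (\<forall>x\<in>carrier M. \<forall>y\<in>carrier M. h (x \<oplus>\<^bsub>M\<^esub> y) = h x \<oplus>\<^bsub>N\<^esub> h y) \<and>
     (\<forall>a\<in>carrier A. \<forall>x\<in>carrier M. h (a \<odot>\<^bsub>M\<^esub> x) = a \<odot>\<^bsub>N\<^esub> h x) \<and>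
     (\<forall>a\<in>carrier A. \<forall>x\<in>carrier M. h (rsmult M x a) = rsmult N (h x) a)}"

text \<open>
  \<open>A \<otimes>\<^sub>E kX \<otimes>\<^sub>E A\<close> for a set \<open>X\<close> of paths and \<open>E = kQ\<^sub>0\<close>: the free abelian group on
  \<open>A \<times> kX \<times> A\<close> modulo the subgroup generated by the additivity relations in each argument and by
  the \<open>E\<close>-balancing relations. Here \<open>E\<close> acts on \<open>A\<close> through the projection and on \<open>kX\<close> through the
  multiplication of the path algebra. As \<open>E\<close> contains the scalars, homogeneity over \<open>k\<close> is part of
  balancing.
\<close>

type_synonym ('v, 'a, 'k) tgen =
  "('v, 'a, 'k) kq set \<times> ('v, 'a, 'k) kq \<times> ('v, 'a, 'k) kq set"
type_synonym ('v, 'a, 'k) tens = "(('v, 'a, 'k) tgen \<Rightarrow>\<^sub>0 int) set"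

definition tens_free :: "('v, 'a) pre_digraph \<Rightarrow> ('v, 'a, 'k::field) kq set \<Rightarrow> ('v, 'a) path set
    \<Rightarrow> (('v, 'a, 'k) tgen \<Rightarrow>\<^sub>0 int) monoid" where
  "tens_free Q I X = free_Abelian_group
     (carrier (quot_alg Q I) \<times> span_paths X \<times> carrier (quot_alg Q I))"

definition tens_rels :: "('v, 'a) pre_digraph \<Rightarrow> ('v, 'a, 'k::field) kq set \<Rightarrow> ('v, 'a) path set
    \<Rightarrow> (('v, 'a, 'k) tgen \<Rightarrow>\<^sub>0 int) set" where
  "tens_rels Q I X =
   (let A = quot_alg Q I; C = carrier A; K = span_paths X; E = span_paths (paths_eq Q 0) in
     {frag_of (a \<oplus>\<^bsub>A\<^esub> a', x, b) - frag_of (a, x, b) - frag_of (a', x, b) | a a' x b.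
        a \<in> C \<and> a' \<in> C \<and> x \<in> K \<and> b \<in> C} \<union>
     {frag_of (a, x + x', b) - frag_of (a, x, b) - frag_of (a, x', b) | a x x' b.
        a \<in> C \<and> x \<in> K \<and> x' \<in> K \<and> b \<in> C} \<union>
     {frag_of (a, x, b \<oplus>\<^bsub>A\<^esub> b') - frag_of (a, x, b) - frag_of (a, x, b') | a x b b'.
        a \<in> C \<and> x \<in> K \<and> b \<in> C \<and> b' \<in> C} \<union>
     {frag_of (a \<otimes>\<^bsub>A\<^esub> proj Q I e, x, b) - frag_of (a, kq_mult e x, b) | a e x b.
        a \<in> C \<and> e \<in> E \<and> x \<in> K \<and> b \<in> C} \<union>
     {frag_of (a, kq_mult x e, b) - frag_of (a, x, proj Q I e \<otimes>\<^bsub>A\<^esub> b) | a x e b.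
        a \<in> C \<and> x \<in> K \<and> e \<in> E \<and> b \<in> C})"

definition tens_sub :: "('v, 'a) pre_digraph \<Rightarrow> ('v, 'a, 'k::field) kq set \<Rightarrow> ('v, 'a) path set
    \<Rightarrow> (('v, 'a, 'k) tgen \<Rightarrow>\<^sub>0 int) set" where
  "tens_sub Q I X = generate (tens_free Q I X) (tens_rels Q I X)"

definition tens_class :: "('v, 'a) pre_digraph \<Rightarrow> ('v, 'a, 'k::field) kq set \<Rightarrow> ('v, 'a) path set
    \<Rightarrow> (('v, 'a, 'k) tgen \<Rightarrow>\<^sub>0 int) \<Rightarrow> ('v, 'a, 'k) tens" where
  "tens_class Q I X \<xi> = tens_sub Q I X #>\<^bsub>tens_free Q I X\<^esub> \<xi>"

definition pure_tensor :: "('v, 'a) pre_digraph \<Rightarrow> ('v, 'a, 'k::field) kq set \<Rightarrow> ('v, 'a) path set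
    \<Rightarrow> ('v, 'a, 'k) kq set \<Rightarrow> ('v, 'a, 'k) kq \<Rightarrow> ('v, 'a, 'k) kq set \<Rightarrow> ('v, 'a, 'k) tens" where
  "pure_tensor Q I X a x b = tens_class Q I X (frag_of (a, x, b))"

text \<open>Elements are cosets; the actions are computed on representatives.\<close>
definition tensor_bimodule :: "('v, 'a) pre_digraph \<Rightarrow> ('v, 'a, 'k::field) kq set
    \<Rightarrow> ('v, 'a) path set \<Rightarrow> (('v, 'a, 'k) kq set, ('v, 'a, 'k) tens) bimodule" where
  "tensor_bimodule Q I X =
   (let A = quot_alg Q I; T = tens_free Q I X Mod tens_sub Q I X in
    \<lparr>carrier = carrier T, mult = undefined, one = undefined, ring.zero = one T, ring.add = mult T,
     smult = (\<lambda>a U. \<Union>\<xi>\<in>U. tens_class Q I X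
       (frag_extend (\<lambda>(b, x, c). frag_of (a \<otimes>\<^bsub>A\<^esub> b, x, c)) \<xi>)),
     rsmult = (\<lambda>U a. \<Union>\<xi>\<in>U. tens_class Q I X
       (frag_extend (\<lambda>(b, x, c). frag_of (b, x, c \<otimes>\<^bsub>A\<^esub> a)) \<xi>))\<rparr>)"

definition resP :: "('v, 'a) pre_digraph \<Rightarrow> ('v, 'a, 'k::field) kq set \<Rightarrow> ('v, 'a, 'k) redsys \<Rightarrow> int
    \<Rightarrow> (('v, 'a, 'k) kq set, ('v, 'a, 'k) tens) bimodule" where
  "resP Q I R n = tensor_bimodule Q I (amb Q R n)"

definition pt :: "('v, 'a) pre_digraph \<Rightarrow> ('v, 'a, 'k::field) kq set \<Rightarrow> ('v, 'a, 'k) redsys \<Rightarrow> int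
    \<Rightarrow> ('v, 'a, 'k) kq set \<Rightarrow> ('v, 'a, 'k) kq \<Rightarrow> ('v, 'a, 'k) kq set \<Rightarrow> ('v, 'a, 'k) tens" where
  "pt Q I R n a x b = pure_tensor Q I (amb Q R n) a x b"

definition one_tensor :: "('v, 'a) pre_digraph \<Rightarrow> ('v, 'a, 'k::field) kq set
    \<Rightarrow> ('v, 'a, 'k) redsys \<Rightarrow> int \<Rightarrow> ('v, 'a) path \<Rightarrow> ('v, 'a, 'k) tens" where
  "one_tensor Q I R n q = pt Q I R n \<one>\<^bsub>quot_alg Q I\<^esub> (pmono1 q) \<one>\<^bsub>quot_alg Q I\<^esub>"

text \<open>Linear span over \<open>k\<close>, where \<open>k\<close> acts on a bimodule through \<open>k \<rightarrow> A\<close>.\<close>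
definition kspan :: "('v, 'a) pre_digraph \<Rightarrow> ('v, 'a, 'k::field) kq set
    \<Rightarrow> (('v, 'a, 'k) kq set, 'm) bimodule \<Rightarrow> 'm set \<Rightarrow> 'm set" where
  "kspan Q I M X = generate (add_monoid M) {proj Q I (kq_const Q c) \<odot>\<^bsub>M\<^esub> x | c x. x \<in> X}"


section \<open>The maps delta\<close>

definition is_delta_aug :: "('v, 'a) pre_digraph \<Rightarrow> ('v, 'a, 'k::field) kq set
    \<Rightarrow> ('v, 'a, 'k) redsys \<Rightarrow> (('v, 'a, 'k) tens \<Rightarrow> ('v, 'a, 'k) kq set) \<Rightarrow> bool" where
  "is_delta_aug Q I R g \<longleftrightarrow>
    (let A = quot_alg Q I in
     g \<in> bimodule_hom A (resP Q I R (-1)) (regular_bimodule A) \<and>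
     (\<forall>a\<in>carrier A. \<forall>x\<in>span_paths (amb Q R (-1)). \<forall>b\<in>carrier A.
        g (pt Q I R (-1) a x b) = a \<otimes>\<^bsub>A\<^esub> proj Q I x \<otimes>\<^bsub>A\<^esub> b))"

text \<open>
  A bimodule map is determined by its values on the elements \<open>1 \<otimes> q \<otimes> 1\<close>, so these predicates
  characterise the maps uniquely on the carriers (and, the two factorizations of an ambiguity being
  unique, the quantification over \<open>us\<close> and \<open>vs\<close> involves one pair for each \<open>q\<close>).
  For \<open>n = 0\<close> the isomorphism \<open>A \<otimes>\<^sub>E A \<cong> A \<otimes>\<^sub>E E \<otimes>\<^sub>E A\<close> sends \<open>a \<otimes> b\<close> to \<open>a \<otimes> 1\<^sub>E \<otimes> b\<close>.
\<close>
definition is_delta :: "('v, 'a) pre_digraph \<Rightarrow> ('v, 'a, 'k::field) kq set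
    \<Rightarrow> ('v, 'a, 'k) redsys \<Rightarrow> nat \<Rightarrow> (('v, 'a, 'k) tens \<Rightarrow> ('v, 'a, 'k) tens) \<Rightarrow> bool" where
  "is_delta Q I R n g \<longleftrightarrow>
    (let A = quot_alg Q I; M = resP Q I R (int n - 1); t = pt Q I R (int n - 1);
         \<pi> = proj Q I in
     g \<in> bimodule_hom A (resP Q I R (int n)) M \<and>
     (\<forall>q\<in>amb Q R (int n).
       (n = 0 \<longrightarrow> g (one_tensor Q I R (int n) q) =
          t (\<pi> (pmono1 q)) (kq_const Q 1) \<one>\<^bsub>A\<^esub> \<ominus>\<^bsub>M\<^esub> t \<one>\<^bsub>A\<^esub> (kq_const Q 1) (\<pi> (pmono1 q))) \<and>
       (n > 0 \<and> even n \<longrightarrow> (\<forall>us vs. left_fact Q R n us q \<and> right_fact Q R n vs q \<longrightarrow>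
          g (one_tensor Q I R (int n) q) =
            t (\<pi> (pmono1 (vs ! n))) (pmono1 (pprod (rev (take n vs)))) \<one>\<^bsub>A\<^esub>
            \<ominus>\<^bsub>M\<^esub> t \<one>\<^bsub>A\<^esub> (pmono1 (pprod (take n us))) (\<pi> (pmono1 (us ! n))))) \<and>
       (odd n \<longrightarrow> g (one_tensor Q I R (int n) q) =
          finsum M (\<lambda>(a, p, c). t (\<pi> (pmono1 a)) (pmono1 p) (\<pi> (pmono1 c)))
            {(a, p, c). a \<in> paths Q \<and> p \<in> amb Q R (int n - 1) \<and> c \<in> paths Q \<and>
               linked a p \<and> linked p c \<and> pcat (pcat a p) c = q})))"


section \<open>The order and the leading terms\<close>

definition kx_paths :: "('v, 'a) pre_digraph \<Rightarrow> ('v, 'a, 'k::field) kq set" where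
  "kx_paths Q = {pmono c p | c p. c \<noteq> 0 \<and> p \<in> paths Q} \<union> {0}"

inductive preceq :: "('v, 'a) pre_digraph \<Rightarrow> ('v, 'a, 'k::field) redsys
    \<Rightarrow> ('v, 'a, 'k) kq \<Rightarrow> ('v, 'a, 'k) kq \<Rightarrow> bool" for Q R where
  refl: "y \<in> kx_paths Q \<Longrightarrow> preceq Q R y y"
| trans: "preceq Q R x y \<Longrightarrow> preceq Q R y z \<Longrightarrow> preceq Q R x z"
| zero: "y \<in> kx_paths Q \<Longrightarrow> preceq Q R 0 y"
| step: "\<lbrakk>l \<noteq> 0; m \<noteq> 0; p \<in> paths Q; q \<in> paths Q; r \<in> reductions Q R;
     r (pmono m q) = pmono l p + x; p \<notin> Poly_Mapping.keys x\<rbrakk> \<Longrightarrow> preceq Q R (pmono l p) (pmono m q)"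

definition prec :: "('v, 'a) pre_digraph \<Rightarrow> ('v, 'a, 'k::field) redsys
    \<Rightarrow> ('v, 'a, 'k) kq \<Rightarrow> ('v, 'a, 'k) kq \<Rightarrow> bool" where
  "prec Q R x y \<longleftrightarrow> preceq Q R x y \<and> x \<noteq> y"

definition Lbar :: "('v, 'a) pre_digraph \<Rightarrow> ('v, 'a, 'k::field) kq set
    \<Rightarrow> ('v, 'a, 'k) redsys \<Rightarrow> int \<Rightarrow> ('v, 'a, 'k) kq \<Rightarrow> ('v, 'a, 'k) tens set" where
  "Lbar Q I R n y = {pt Q I R n (proj Q I (pmono l b)) (pmono1 p) (proj Q I (pmono1 b')) | l b p b'.
     b \<in> irr_paths Q R \<and> b' \<in> irr_paths Q R \<and> p \<in> amb Q R n \<and>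
     prec Q R (kq_mult (kq_mult (pmono l b) (pmono1 p)) (pmono1 b')) y}"


section \<open>Resolutions and minimality\<close>

text \<open>\<open>aug\<close> is the map called \<open>d\<close> in degree -1, from degree -1 to \<open>A\<close>; \<open>d n\<close> maps degree \<open>n\<close> to degree \<open>n - 1\<close>.\<close>
definition is_resolution :: "('v, 'a) pre_digraph \<Rightarrow> ('v, 'a, 'k::field) kq set
    \<Rightarrow> ('v, 'a, 'k) redsys \<Rightarrow> (('v, 'a, 'k) tens \<Rightarrow> ('v, 'a, 'k) kq set)
    \<Rightarrow> (nat \<Rightarrow> ('v, 'a, 'k) tens \<Rightarrow> ('v, 'a, 'k) tens) \<Rightarrow> bool" where
  "is_resolution Q I R aug d \<longleftrightarrow>
    (let A = quot_alg Q I in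
     aug \<in> bimodule_hom A (resP Q I R (-1)) (regular_bimodule A) \<and>
     (\<forall>n. d n \<in> bimodule_hom A (resP Q I R (int n)) (resP Q I R (int n - 1))) \<and>
     aug ` carrier (resP Q I R (-1)) = carrier A \<and>
     d 0 ` carrier (resP Q I R 0) = a_kernel (resP Q I R (-1)) A aug \<and>
     (\<forall>n. d (Suc n) ` carrier (resP Q I R (int n + 1))
          = a_kernel (resP Q I R (int n)) (resP Q I R (int n - 1)) (d n)))"

definition rad_part :: "('v, 'a) pre_digraph \<Rightarrow> ('v, 'a, 'k::field) kq set
    \<Rightarrow> (('v, 'a, 'k) kq set, 'm) bimodule \<Rightarrow> 'm set" where
  "rad_part Q I M =
    (let J = proj Q I ` span_paths (paths_ge Q 1) in
     generate (add_monoid M) {j \<odot>\<^bsub>M\<^esub> x | j x. j \<in> J \<and> x \<in> carrier M}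
     <+>\<^bsub>M\<^esub> generate (add_monoid M) {rsmult M x j | j x. j \<in> J \<and> x \<in> carrier M})"

definition minimal :: "('v, 'a) pre_digraph \<Rightarrow> ('v, 'a, 'k::field) kq set
    \<Rightarrow> ('v, 'a, 'k) redsys \<Rightarrow> (nat \<Rightarrow> ('v, 'a, 'k) tens \<Rightarrow> ('v, 'a, 'k) tens) \<Rightarrow> bool" where
  "minimal Q I R d \<longleftrightarrow>
    (\<forall>n. d n ` carrier (resP Q I R (int n)) \<subseteq> rad_part Q I (resP Q I R (int n - 1)))"

end

theory Submission
  imports Defs
begin

text \<open>Two obstacles shape the proof. For even \<open>n\<close> the value of
  \<open>\<delta> n\<close> is given only for a pair of factorizations, while membership in
  \<open>amb\<close> supplies just the left one, so a right factorization has to be built. As all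
  left sides of relations have the same length \<open>N\<close>, an occurrence of one of them in a
  path is just a starting position, and both factorizations become sequences of cut points. On the
  left, \<open>C (j + 2)\<close> is the end of the earliest occurrence starting at or after
  \<open>C j\<close>; on the right, \<open>D (j + 2)\<close> is the start of the latest occurrence
  ending at or before \<open>D j\<close>. Interlacing the two shows that the cuts from the right
  reach the beginning of the word after exactly \<open>n + 1\<close> pieces. The other obstacle is
  that tensors are cosets and the radical is a sum of two generated subgroups. It is replaced by
  \<open>Rad\<close>, the image of one explicit subgroup of the free abelian group that is stable
  under both actions, so that membership is decided on representatives.\<close>

text \<open>
  All relations are homogeneous, so reductions preserve the length of paths. Hence a term
  \<open>\<lambda> \<pi>(b) \<otimes> p \<otimes> \<pi>(b')\<close> with \<open>\<lambda> b p b' \<prec> q\<close> and \<open>p\<close> shorter than \<open>q\<close> either vanishes or has a path \<open>b\<close>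
  or \<open>b'\<close> of positive length, and so it lies in the radical. The same comparison of lengths settles
  \<open>\<delta>\<^sub>n\<close> for odd \<open>n\<close>; for even \<open>n\<close> the outer factors \<open>v\<^sub>n\<close> and \<open>u\<^sub>n\<close> have positive length because
  \<open>v\<^sub>n\<^sub>-\<^sub>1\<close> and \<open>u\<^sub>n\<^sub>-\<^sub>1\<close> are irreducible. So \<open>d\<^sub>n\<close> maps the bimodule generators into the radical.
\<close>

section \<open>Factors of words\<close>

definition slice :: "nat \<Rightarrow> nat \<Rightarrow> 'x list \<Rightarrow> 'x list" where
  "slice i j xs = take (j - i) (drop i xs)"

lemma length_slice: "j \<le> length xs \<Longrightarrow> length (slice i j xs) = j - i"
  by (simp add: slice_def)

lemma slice_append:
  assumes "i \<le> j" "j \<le> k"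
  shows "slice i j xs @ slice j k xs = slice i k xs"
proof -
  have "slice i k xs = take ((j - i) + (k - j)) (drop i xs)"
    using assms by (simp add: slice_def)
  also have "\<dots> = slice i j xs @ slice j k xs"
    unfolding take_add slice_def using assms by simp
  finally show ?thesis ..
qed

lemma take_slice: "i + m \<le> j \<Longrightarrow> take m (slice i j xs) = slice i (i + m) xs"
  by (simp add: slice_def min_def)

lemma drop_slice: "i + m \<le> j \<Longrightarrow> drop m (slice i j xs) = slice (i + m) j xs"
  by (simp add: slice_def drop_take add.commute)

definition has_factor_in :: "'x list set \<Rightarrow> 'x list \<Rightarrow> bool" where
  "has_factor_in W xs \<longleftrightarrow> (\<exists>ys w zs. w \<in> W \<and> xs = ys @ w @ zs)"

definition occurrences :: "'x list set \<Rightarrow> nat \<Rightarrow> 'x list \<Rightarrow> nat set" where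
  "occurrences W N xs = {k. k + N \<le> length xs \<and> slice k (k + N) xs \<in> W}"

text \<open>All words of \<open>W\<close> have the same length, so the start of an occurrence
  determines its end. Reducibility of a subpath thereby becomes an inequality between
  positions.\<close>

lemma has_factor_in_slice_iff:
  assumes W: "\<And>w. w \<in> W \<Longrightarrow> length w = N" and ij: "i \<le> j" "j \<le> length xs"
  shows "has_factor_in W (slice i j xs) \<longleftrightarrow> (\<exists>k\<in>occurrences W N xs. i \<le> k \<and> k + N \<le> j)"
proof
  assume "has_factor_in W (slice i j xs)"
  then obtain ys w zs where w: "w \<in> W" "slice i j xs = ys @ w @ zs"
    by (auto simp: has_factor_in_def)
  let ?k = "i + length ys"
  have l: "j - i = length ys + N + length zs"
    using arg_cong[OF w(2), of length] W[OF w(1)] ij by (simp add: length_slice)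
  have "w = take N (drop (length ys) (slice i j xs))"
    using W[OF w(1)] by (simp add: w(2))
  also have "\<dots> = slice ?k (?k + N) xs"
    using l ij by (simp add: drop_slice take_slice)
  finally show "\<exists>k\<in>occurrences W N xs. i \<le> k \<and> k + N \<le> j"
    using w(1) l ij by (intro bexI[of _ ?k]) (auto simp: occurrences_def)
next
  assume "\<exists>k\<in>occurrences W N xs. i \<le> k \<and> k + N \<le> j"
  then obtain k where k: "slice k (k + N) xs \<in> W" "i \<le> k" "k + N \<le> j"
    by (auto simp: occurrences_def)
  have "slice i j xs = slice i k xs @ slice k (k + N) xs @ slice (k + N) j xs"
    using k ij by (simp add: slice_append)
  then show "has_factor_in W (slice i j xs)"
    using k(1) by (auto simp: has_factor_in_def)
qed

text \<open>The cut points run from the right end of the word to its beginning, whence the reversed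
  order of the pieces. The bound on \<open>D m\<close> is carried through the induction because
  joining slices needs it.\<close>

lemma concat_rev_slices:
  assumes "\<And>i. i < m \<Longrightarrow> D (Suc i) \<le> D i" "D 0 = length xs"
  shows "concat (map (\<lambda>i. slice (D (Suc i)) (D i) xs) (rev [0..<m])) = drop (D m) xs \<and> D m \<le> length xs"
  using assms(1)
proof (induction m)
  case (Suc m)
  then have IH: "concat (map (\<lambda>i. slice (D (Suc i)) (D i) xs) (rev [0..<m])) = drop (D m) xs"
    "D m \<le> length xs" "D (Suc m) \<le> D m"
    by auto
  have s: "slice i (length xs) xs = drop i xs" for i
    by (simp add: slice_def)
  show ?case
    using IH slice_append[OF IH(3,2), of xs] by (simp add: s)
qed (simp add: assms)

text \<open>
  In the application, \<open>P\<close> is the set of starting positions of the elements of \<open>S\<close> (all of length \<open>N\<close>)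
  in an ambiguity of length \<open>L\<close>, the numbers \<open>C j\<close> are the cut points of its left factorization
  and the numbers \<open>D j\<close>, numbered from the right end, are those of its right factorization. The two
  sequences interlace: \<open>C (n + 1 - j) - N \<le> D (j + 2) < C (n - j)\<close>.
\<close>
lemma dual_chain:
  fixes C :: "nat \<Rightarrow> nat" and P :: "nat set"
  assumes n: "n \<ge> 1" and N: "N \<ge> 2" and C1: "C 1 = 1" and CL: "C (Suc n) = L"
    and "\<forall>j<n. \<exists>k\<in>P. C (j + 2) = k + N \<and> C j \<le> k \<and> k < C (j + 1)"
    and "\<forall>j<n. \<forall>k\<in>P. C j \<le> k \<longrightarrow> C (j + 2) \<le> k + N"
  obtains D :: "nat \<Rightarrow> nat" where "D 0 = L" "D 1 = L - 1" "D (Suc n) = 0"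
    "\<forall>j<n. D (j + 2) \<in> P \<and> D (j + 2) + N \<le> D j \<and> D (j + 1) < D (j + 2) + N"
    "\<forall>j<n. \<forall>k\<in>P. k + N \<le> D j \<longrightarrow> k \<le> D (j + 2)"
proof -
  have chain: "\<exists>k\<in>P. C (j + 2) = k + N \<and> C j \<le> k \<and> k < C (j + 1)" if "j < n" for j
    using assms that by blast
  have least: "C (j + 2) \<le> k + N" if "j < n" "k \<in> P" "C j \<le> k" for j k
    using assms that by blast
  define T where "T m = {k \<in> P. k + N \<le> m}" for m
  \<comment> \<open>The recursion has two steps, \<open>D (j + 2)\<close> depending on
    \<open>D j\<close> alone; iterating on pairs expresses it. The two initial values cut off the
    last arrow.\<close>
  define D where "D j = fst (((\<lambda>(x, y). (y, Max (T x))) ^^ j) (L, L - 1))" for j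
  have D2: "D (j + 2) = Max (T (D j))" for j
    by (simp add: D_def split_beta)
  have D0: "D 0 = L" and D1: "D 1 = L - 1"
    by (simp_all add: D_def)
  have fin: "finite (T m)" for m
    by (rule finite_subset[of _ "{..m}"]) (auto simp: T_def)
  have max: "k \<le> D (j + 2)" if "k \<in> P" "k + N \<le> D j" for j k
    unfolding D2 using that fin by (intro Max_ge) (auto simp: T_def)
  \<comment> \<open>\<open>Max\<close> is meaningful only on a nonempty set, so a witness
    \<open>k\<close> is required here.\<close>
  have mem: "D (j + 2) \<in> P \<and> D (j + 2) + N \<le> D j" if "k \<in> P" "k + N \<le> D j" for j k
    using Max_in[OF fin, of "D j"] that unfolding D2 by (auto simp: T_def)
  have incr: "C j < C (Suc j)" if "0 < j" "j \<le> n" for j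
  proof (cases "j = 1")
    case True
    have "0 < n" using n by simp
    from chain[OF this] obtain k where "C (0 + 2) = k + N" "k < C (0 + 1)" by blast
    then show ?thesis using True C1 N by (simp add: numeral_2_eq_2)
  next
    \<comment> \<open>With \<open>j = i + 2\<close>, the occurrence ending at \<open>C j\<close>
      starts before \<open>C (i + 1)\<close>, and the one ending at \<open>C (Suc j)\<close> starts
      at or after it.\<close>
    case False
    have "j = (j - 2) + 2" using that(1) False by simp
    then obtain i where i: "j = i + 2" by blast
    have "i < n" "Suc i < n" using that i by auto
    from chain[OF this(1)] chain[OF this(2)] show ?thesis unfolding i by fastforce
  qed
  \<comment> \<open>The interlacing. Each \<open>D (j + 2)\<close> is compared with
    \<open>D j\<close>, so the induction advances by two and has two base cases.\<close>
  have key: "D (j + 2) \<in> P \<and> D (j + 2) + N \<le> D j \<and> C (Suc n - j) \<le> D (j + 2) + N \<and> D (j + 2) < C (n - j)"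
    if "j < n" for j
    using that
  proof (induction j rule: induct_nat_012)
    case 0
    obtain k where k: "k \<in> P" "C (Suc n) = k + N" "k < C n"
      using chain[of "n - 1"] n by auto
    then have m: "D (0 + 2) \<in> P" "D (0 + 2) + N \<le> D 0"
      using mem[of k 0] D0 CL by simp_all
    moreover have "k \<le> D (0 + 2)" using max[of k 0] k D0 CL by simp
    ultimately show ?case using k D0 CL by simp
  next
    case 1
    obtain k where k: "k \<in> P" "C n = k + N" 
      using chain[of "n - 2"] 1 by (auto simp: numeral_2_eq_2 Suc_diff_Suc)
    have "C n < L" using incr[of n] CL n by simp
    then have m: "D (1 + 2) \<in> P" "D (1 + 2) + N \<le> D 1" "k \<le> D (1 + 2)"
      using mem[of k 1] max[of k 1] D1 k by auto
    \<comment> \<open>Otherwise \<open>least\<close> would make the occurrence at \<open>D 3\<close>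
      end at \<open>L\<close> or later, although it ends by \<open>D 1 = L - 1\<close>.\<close>
    moreover have "D (1 + 2) < C (n - 1)"
      using least[of "n - 1" "D (1 + 2)"] m D1 CL n N by force
    ultimately show ?case using k by simp
  next
    case (ge2 j)
    then have "n = (n - 3 - j) + 3 + j" by simp
    then obtain i where i: "n = i + 3 + j" by blast
    have IH: "D (j + 2) + N \<ge> C (i + 4)" "D (j + 2) < C (i + 3)"
      using ge2.IH(1) i by (simp_all add: numeral_eq_Suc)
    obtain k where k: "k \<in> P" "C (i + 2) = k + N"
      using chain[of i] i by auto
    obtain k' where k': "k' \<in> P" "C (i + 4) = k' + N" "C (i + 2) \<le> k'"
      using chain[of "i + 2"] i by (auto simp: numeral_eq_Suc)
    \<comment> \<open>Comparing ends gives \<open>k' \<le> D (j + 2)\<close>, and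
      \<open>k + N = C (i + 2) \<le> k'\<close>; so \<open>k\<close> is a candidate in the maximum
      that defines \<open>D (j + 4)\<close>.\<close>
    have kD: "k + N \<le> D (j + 2)" using k k' IH by simp
    have m: "D (j + 2 + 2) \<in> P" "D (j + 2 + 2) + N \<le> D (j + 2)" "k \<le> D (j + 2 + 2)"
      using mem[OF k(1) kD] max[OF k(1) kD] by auto
    have "D (j + 2 + 2) < C (i + 1)"
    proof (rule ccontr)
      assume "\<not> D (j + 2 + 2) < C (i + 1)"
      then have "C (i + 1 + 2) \<le> D (j + 2 + 2) + N"
        using least[of "i + 1"] m(1) i by simp
      then show False using m(2) IH(2) by (simp add: numeral_eq_Suc)
    qed
    then show ?case using k m i by (simp add: numeral_eq_Suc)
  qed
  show ?thesis
  proof (rule that[of D])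
    show "D 0 = L" "D 1 = L - 1" by fact+
    \<comment> \<open>At \<open>j = n - 1\<close> the interlacing bounds \<open>D (Suc n)\<close>
      strictly by \<open>C 1 = 1\<close>.\<close>
    show "D (Suc n) = 0" using key[of "n - 1"] n C1 by auto
    show "\<forall>j<n. D (j + 2) \<in> P \<and> D (j + 2) + N \<le> D j \<and> D (j + 1) < D (j + 2) + N"
    proof (intro allI impI)
      fix j assume j: "j < n"
      \<comment> \<open>For \<open>j = Suc i\<close>, two neighbouring instances of
        \<open>key\<close> combine to \<open>D (i + 2) < C (n - i) \<le> D (i + 3) + N\<close>. This
        overlap will make the right factors irreducible.\<close>
      have "D (j + 1) < D (j + 2) + N"
      proof (cases j)
        case 0
        then show ?thesis using key[OF j] D1 CL n N incr[of n] by auto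
      next
        case (Suc i)
        then show ?thesis using key[OF j] key[of i] j by auto
      qed
      then show "D (j + 2) \<in> P \<and> D (j + 2) + N \<le> D j \<and> D (j + 1) < D (j + 2) + N"
        using key[OF j] by blast
    qed
    show "\<forall>j<n. \<forall>k\<in>P. k + N \<le> D j \<longrightarrow> k \<le> D (j + 2)"
      using max by blast
  qed
qed


lemma slice_concat:
  assumes "i < length xss"
  shows "slice (length (concat (take i xss))) (length (concat (take (Suc i) xss))) (concat xss) = xss ! i"
proof -
  have "concat xss = concat (take i xss) @ xss ! i @ concat (drop (Suc i) xss)"
    by (subst id_take_nth_drop[OF assms]) simp
  then show ?thesis
    using assms by (simp add: slice_def take_Suc_conv_app_nth)
qed

section \<open>Paths and reducibility\<close>

lemma psrc_pcat [simp]: "psrc (pcat p q) = psrc p"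
  and ptgt_pcat [simp]: "ptgt (pcat p q) = ptgt q"
  and parcs_pcat [simp]: "parcs (pcat p q) = parcs p @ parcs q"
  by (simp_all add: pcat_def psrc_def ptgt_def parcs_def)

lemma psrc_triple [simp]: "psrc (u, xs, v) = u"
  and ptgt_triple [simp]: "ptgt (u, xs, v) = v"
  and parcs_triple [simp]: "parcs (u, xs, v) = xs"
  by (simp_all add: psrc_def ptgt_def parcs_def)

lemma path_eqI: "psrc p = psrc q \<Longrightarrow> parcs p = parcs q \<Longrightarrow> ptgt p = ptgt q \<Longrightarrow> p = q"
  by (simp add: psrc_def ptgt_def parcs_def prod_eq_iff)

lemma parcs_pprod [simp]: "parcs (pprod ps) = concat (map parcs ps)"
  by (simp add: pprod_def)

lemma pprod_Cons: "ps \<noteq> [] \<Longrightarrow> pprod (p # ps) = pcat p (pprod ps)"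
  by (simp add: pprod_def pcat_def psrc_def ptgt_def parcs_def)

lemma pprod_single: "pprod [p] = p"
  by (simp add: path_eqI pprod_def)

lemma kq_mult_in_span:
  assumes "x \<in> span_paths X" "y \<in> span_paths Y"
    and "\<And>p q. p \<in> X \<Longrightarrow> q \<in> Y \<Longrightarrow> linked p q \<Longrightarrow> pcat p q \<in> Z"
  shows "kq_mult x y \<in> span_paths Z"
  unfolding kq_mult_def
proof (intro span_paths_sum)
  fix p q assume "p \<in> Poly_Mapping.keys x" "q \<in> Poly_Mapping.keys y"
  then have "p \<in> X" "q \<in> Y" using assms by (auto simp: span_paths_def)
  then show "(if linked p q
      then pmono (Poly_Mapping.lookup x p * Poly_Mapping.lookup y q) (pcat p q) else 0) \<in> span_paths Z"
    using assms(3)[of p q] by (cases "linked p q") (simp_all add: pmono_in_span, simp add: span_paths_def)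
qed

lemma zero_in_span [simp]: "0 \<in> span_paths X"
  by (simp add: span_paths_def)

lemma span_paths_mono: "X \<subseteq> Y \<Longrightarrow> span_paths X \<subseteq> span_paths Y"
  by (auto simp: span_paths_def)

lemma plen_pcat [simp]: "plen (pcat p q) = plen p + plen q"
  by (simp add: plen_def)

lemma paths_ge_iff: "p \<in> paths_ge Q n \<longleftrightarrow> p \<in> paths Q \<and> n \<le> plen p"
  by (auto simp: paths_ge_def paths_eq_def)

lemma span_paths_ge: "x \<in> span_paths (paths_ge Q n) \<Longrightarrow> x \<in> span_paths (paths Q)"
  by (auto simp: span_paths_def paths_ge_iff)

section \<open>Effect of a basic reduction on a single path\<close>

lemma basic_reduction_pmono1:
  "basic_reduction a s f c (pmono1 p :: ('v, 'a, 'k::field) kq) =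
    (if p = pcat (pcat a s) c then kq_mult (kq_mult (pmono1 a) f) (pmono1 c) else pmono1 p)"
  by (simp add: basic_reduction_def pmono_def)

lemma kq_mult_pmono1_both:
  fixes f :: "('v, 'a, 'k::field) kq"
  assumes "\<And>p. p \<in> Poly_Mapping.keys f \<Longrightarrow> linked a p \<and> linked p c"
  shows "kq_mult (kq_mult (pmono d a) f) (pmono1 c) =
    (\<Sum>p\<in>Poly_Mapping.keys f. pmono (d * Poly_Mapping.lookup f p) (pcat (pcat a p) c))"
proof -
  have "kq_mult (kq_mult (pmono d a) (\<Sum>p\<in>Poly_Mapping.keys f. pmono (Poly_Mapping.lookup f p) p)) (pmono1 c)
      = (\<Sum>p\<in>Poly_Mapping.keys f. pmono (d * Poly_Mapping.lookup f p) (pcat (pcat a p) c))"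
    unfolding kq_mult_sum_right kq_mult_sum_left
  proof (intro sum.cong HOL.refl)
    fix p assume "p \<in> Poly_Mapping.keys f"
    then have "linked a p" "linked p c" using assms by auto
    then show "kq_mult (kq_mult (pmono d a) (pmono (Poly_Mapping.lookup f p) p)) (pmono1 c) =
        pmono (d * Poly_Mapping.lookup f p) (pcat (pcat a p) c)"
      by (simp add: kq_mult_pmono)
  qed
  then show ?thesis by (simp only: sum_pmono[symmetric])
qed

text \<open>A product does not record the endpoints of its middle factor, so these have to agree
  beforehand.\<close>

lemma pcat_both_cancel:
  assumes "pcat (pcat a p) c = pcat (pcat a q) c" "psrc p = psrc q" "ptgt p = ptgt q"
  shows "p = q"
proof (rule path_eqI)
  have "parcs (pcat (pcat a p) c) = parcs (pcat (pcat a q) c)"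
    using assms(1) by (rule arg_cong)
  then show "parcs p = parcs q" by simp
qed fact+

text \<open>On parallel paths, multiplication by \<open>a\<close> and \<open>c\<close> is injective,
  so the coefficients of \<open>f\<close> reappear unchanged in the product \<open>a f c\<close>.
  Equality with \<open>a s c\<close> would therefore force \<open>f = s\<close>. Hence a path with a
  divisor \<open>s\<close> is really moved by the corresponding reduction.\<close>

lemma reduced_ne:
  fixes f :: "('v, 'a, 'k::field) kq"
  assumes par: "parallel f s" and ne: "f \<noteq> pmono1 s" and l: "linked a s" "linked s c"
  shows "kq_mult (kq_mult (pmono1 a) f) (pmono1 c) \<noteq> pmono1 (pcat (pcat a s) c)"
proof
  assume eq: "kq_mult (kq_mult (pmono1 a) f) (pmono1 c) = pmono1 (pcat (pcat a s) c)"
  have k: "linked a p \<and> linked p c \<and> psrc p = psrc s \<and> ptgt p = ptgt s"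
    if "p \<in> Poly_Mapping.keys f" for p
    using that par l by (auto simp: parallel_def linked_def)
  have lk: "Poly_Mapping.lookup (kq_mult (kq_mult (pmono1 a) f) (pmono1 c)) (pcat (pcat a q) c) =
      Poly_Mapping.lookup f q" if q: "psrc q = psrc s" "ptgt q = ptgt s" for q
  proof -
    have "pcat (pcat a p) c = pcat (pcat a q) c \<longleftrightarrow> p = q" if "p \<in> Poly_Mapping.keys f" for p
      using pcat_both_cancel[of a p c q] k[OF that] q by auto
    then have "Poly_Mapping.lookup (kq_mult (kq_mult (pmono1 a) f) (pmono1 c)) (pcat (pcat a q) c) =
        (\<Sum>p\<in>Poly_Mapping.keys f. if p = q then Poly_Mapping.lookup f p else 0)"
      using k by (subst kq_mult_pmono1_both)
        (simp_all add: lookup_sum pmono_def lookup_single when_def)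
    then show ?thesis by (simp add: in_keys_iff)
  qed
  have "Poly_Mapping.lookup f q = Poly_Mapping.lookup (pmono1 s) q" for q
  proof (cases "psrc q = psrc s \<and> ptgt q = ptgt s")
    case True
    then have "pcat (pcat a s) c = pcat (pcat a q) c \<longleftrightarrow> s = q"
      using pcat_both_cancel[of a s c q] by auto
    then show ?thesis
      using lk[of q] True unfolding eq by (simp add: pmono_def lookup_single when_def)
  next
    case False
    then have "q \<notin> Poly_Mapping.keys f" "q \<noteq> s" using k[of q] by blast+
    then show ?thesis by (simp add: in_keys_iff pmono_def lookup_single)
  qed
  then show False using ne poly_mapping_eqI by blast
qed

section \<open>Cutting paths, and irreducibility as a property of words\<close>

context wf_digraph
begin

lemma trivial_path:
  assumes "p \<in> paths G" "parcs p = []"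
  shows "psrc p = ptgt p"
  using assms by (simp add: paths_def awalk_Nil_iff)

text \<open>Lets words be compared in place of paths. Vertices are excluded, as they all share the
  empty word.\<close>

lemma paths_eqI:
  assumes "p \<in> paths G" "q \<in> paths G" "parcs p = parcs q" "parcs p \<noteq> []"
  shows "p = q"
proof (rule path_eqI)
  have awlast: "ptgt r = awlast (psrc r) (parcs r)" if "r \<in> paths G" for r
    using that by (auto simp: paths_def awalk_def dest: awlast_if_cas)
  have src: "psrc r = tail G (hd (parcs r))" if "r \<in> paths G" "parcs r \<noteq> []" for r
    using that by (cases "parcs r") (simp_all add: paths_def awalk_Cons_iff)
  show "psrc p = psrc q" "ptgt p = ptgt q"
    using assms src[of p] src[of q] awlast[of p] awlast[of q] by simp_all
qed fact

lemma split_path2: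
  assumes "p \<in> paths G" "parcs p = xs @ ys"
  obtains p1 p2 where "p1 \<in> paths G" "p2 \<in> paths G" "linked p1 p2" "p = pcat p1 p2"
    "parcs p1 = xs" "parcs p2 = ys"
proof
  let ?m = "awlast (psrc p) xs"
  show "(psrc p, xs, ?m) \<in> paths G" "(?m, ys, ptgt p) \<in> paths G"
    using assms by (auto simp: paths_def)
qed (use assms in \<open>auto simp: linked_def intro: path_eqI\<close>)

lemma split_path:
  assumes "p \<in> paths G" "parcs p = concat xss" "xss \<noteq> []"
  obtains ps where "map parcs ps = xss" "set ps \<subseteq> paths G" "successively linked ps" "pprod ps = p"
proof -
  have "\<exists>ps. map parcs ps = xss \<and> set ps \<subseteq> paths G \<and> successively linked ps \<and> pprod ps = p"
    using assms
  proof (induction xss arbitrary: p)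
    case (Cons xs xss)
    show ?case
    proof (cases "xss = []")
      case True
      then show ?thesis using Cons.prems by (intro exI[of _ "[p]"]) (simp add: pprod_single)
    next
      case False
      obtain p1 p2 where p12: "p1 \<in> paths G" "p2 \<in> paths G" "linked p1 p2" "p = pcat p1 p2"
        "parcs p1 = xs" "parcs p2 = concat xss"
        by (rule split_path2[OF Cons.prems(1), of xs "concat xss"]) (use Cons.prems in auto)
      from Cons.IH[OF p12(2,6) False] obtain ps where
        ps: "map parcs ps = xss" "set ps \<subseteq> paths G" "successively linked ps" "pprod ps = p2"
        by blast
      have ne: "ps \<noteq> []" using ps(1) False by auto
      have "psrc (hd ps) = psrc p2" using ps(4) by (auto simp: pprod_def)
      then have "successively linked (p1 # ps)"
        using ps(3) p12(3) ne by (cases ps) (auto simp: linked_def)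
      then show ?thesis
        using ps p12 ne by (intro exI[of _ "p1 # ps"]) (auto simp: pprod_Cons)
    qed
  qed simp
  then show ?thesis using that by blast
qed

lemma left_divisor_iff:
  assumes "d \<in> paths G"
  shows "left_divisor G d p \<longleftrightarrow> (\<exists>b\<in>paths G. linked d b \<and> p = pcat d b)"
proof
  assume "left_divisor G d p"
  then obtain a b where *: "a \<in> paths_eq G 0" "b \<in> paths G" "linked a d" "linked d b" "p = pcat (pcat a d) b"
    by (auto simp: left_divisor_def)
  have "pcat a d = d"
    using * trivial_path[of a] by (intro path_eqI) (auto simp: paths_eq_def plen_def linked_def)
  then show "\<exists>b\<in>paths G. linked d b \<and> p = pcat d b" using * by auto
next
  assume "\<exists>b\<in>paths G. linked d b \<and> p = pcat d b"
  then obtain b where *: "b \<in> paths G" "linked d b" "p = pcat d b" by auto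
  have "psrc d \<in> verts G" using psrc_ptgt_in_verts[OF wf_digraph_axioms assms] by blast
  then have "(psrc d, [], psrc d) \<in> paths_eq G 0"
    using vertex_paths[OF wf_digraph_axioms] by (simp add: paths_eq_def plen_def)
  moreover have "p = pcat (pcat (psrc d, [], psrc d) d) b"
    using * by (auto intro: path_eqI)
  ultimately show "left_divisor G d p"
    using * unfolding left_divisor_def by (metis linked_def ptgt_triple)
qed

lemma right_divisor_iff:
  assumes "d \<in> paths G"
  shows "right_divisor G d p \<longleftrightarrow> (\<exists>a\<in>paths G. linked a d \<and> p = pcat a d)"
proof
  assume "right_divisor G d p"
  then obtain a b where *: "a \<in> paths G" "b \<in> paths_eq G 0" "linked a d" "linked d b" "p = pcat (pcat a d) b"
    by (auto simp: right_divisor_def)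
  have "pcat (pcat a d) b = pcat a d"
    using * trivial_path[of b] by (intro path_eqI) (auto simp: paths_eq_def plen_def linked_def)
  then show "\<exists>a\<in>paths G. linked a d \<and> p = pcat a d" using * by auto
next
  assume "\<exists>a\<in>paths G. linked a d \<and> p = pcat a d"
  then obtain a where *: "a \<in> paths G" "linked a d" "p = pcat a d" by auto
  have "ptgt d \<in> verts G" using psrc_ptgt_in_verts[OF wf_digraph_axioms assms] by blast
  then have "(ptgt d, [], ptgt d) \<in> paths_eq G 0"
    using vertex_paths[OF wf_digraph_axioms] by (simp add: paths_eq_def plen_def)
  moreover have "p = pcat (pcat a d) (ptgt d, [], ptgt d)"
    using * by (auto intro: path_eqI)
  ultimately show "right_divisor G d p"
    using * unfolding right_divisor_def by (metis linked_def psrc_triple)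
qed

lemma pcat_vertex_left:
  assumes "v \<in> paths_eq G 0" "linked v p"
  shows "pcat v p = p"
  using assms trivial_path[of v] by (intro path_eqI) (auto simp: paths_eq_def plen_def linked_def)

lemma pcat_vertex_right:
  assumes "v \<in> paths_eq G 0" "linked p v"
  shows "pcat p v = p"
  using assms trivial_path[of v] by (intro path_eqI) (auto simp: paths_eq_def plen_def linked_def)

lemma pprod_in_paths:
  assumes "ps \<noteq> []" "set ps \<subseteq> paths G" "successively linked ps"
  shows "pprod ps \<in> paths G"
  using assms
proof (induction ps rule: list_nonempty_induct)
  case (cons p ps)
  then have "psrc (pprod ps) = psrc (hd ps)" by (simp add: pprod_def)
  then have "linked p (pprod ps)" using cons by (cases ps) (auto simp: linked_def)
  then show ?case using cons by (auto simp: pprod_Cons successively_Cons intro!: pcat_in_paths[OF wf_digraph_axioms])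
qed (simp add: pprod_single)

lemma left_fact_paths:
  assumes "left_fact G R n us q"
  shows "set us \<subseteq> paths G"
proof -
  have "us ! i \<in> paths G" if "i < length us" for i
    using that assms by (cases i) (auto simp: left_fact_def paths_eq_def irr_paths_def)
  then show ?thesis by (metis in_set_conv_nth subsetI)
qed

lemma left_fact_in_paths:
  assumes "left_fact G R n us q"
  shows "q \<in> paths G"
proof -
  have "us \<noteq> []" "successively linked us" "q = pprod us"
    using assms by (auto simp: left_fact_def)
  then show ?thesis using pprod_in_paths left_fact_paths[OF assms] by metis
qed

text \<open>The link between paths and words. Left sides of relations must contain arrows: the empty
  word is a factor of every word, whichever vertex it came from.\<close>

lemma irred_path_iff:
  assumes rs: "reduction_system G R" and ne: "\<And>s. s \<in> fst ` R \<Longrightarrow> parcs s \<noteq> []" and p: "p \<in> paths G"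
  shows "irred_path G R p \<longleftrightarrow> \<not> has_factor_in (parcs ` fst ` R) (parcs p)"
proof
  assume irr: "irred_path G R p"
  show "\<not> has_factor_in (parcs ` fst ` R) (parcs p)"
  proof
    assume "has_factor_in (parcs ` fst ` R) (parcs p)"
    then obtain ys zs s f where sf: "(s, f) \<in> R" "parcs p = ys @ parcs s @ zs"
      by (auto simp: has_factor_in_def)
    obtain a p' where a: "a \<in> paths G" "p' \<in> paths G" "linked a p'" "p = pcat a p'" "parcs p' = parcs s @ zs"
      using split_path2[OF p sf(2)] by metis
    obtain s' c where s': "s' \<in> paths G" "c \<in> paths G" "linked s' c" "p' = pcat s' c" "parcs s' = parcs s"
      using split_path2[OF a(2,5)] by metis
    have sR: "s \<in> paths G" "parallel f s" "f \<noteq> pmono1 s"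
      using rs sf(1) unfolding reduction_system_def by auto
    \<comment> \<open>Splitting the word yields only some path with the arrows of \<open>s\<close>;
      being nontrivial, it is \<open>s\<close> itself.\<close>
    have "s' = s" using paths_eqI[OF s'(1) sR(1) s'(5)] ne[of s] sf(1) s'(5) by force
    then have l: "linked a s" "linked s c" "p = pcat (pcat a s) c"
      using a s' by (auto simp: pcat_assoc)
    have "basic_reduction a s f c \<in> basic_reductions G R"
      unfolding basic_reductions_def using sf(1) a(1) s'(2) l(1,2) by blast
    then have "basic_reduction a s f c (pmono1 p) = pmono1 p"
      using irr by (simp add: irreducible_elt_def)
    then show False
      using reduced_ne[OF sR(2,3) l(1,2)] l(3) by (simp add: basic_reduction_pmono1)
  qed
next
  assume nf: "\<not> has_factor_in (parcs ` fst ` R) (parcs p)"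
  show "irred_path G R p"
    unfolding irreducible_elt_def
  proof
    fix r :: "('a, 'b, 'c) kq \<Rightarrow> ('a, 'b, 'c) kq" assume "r \<in> basic_reductions G R"
    then obtain a s f c where r: "r = basic_reduction a s f c" "(s, f) \<in> R"
      by (auto simp: basic_reductions_def)
    have "p \<noteq> pcat (pcat a s) c"
    proof
      assume "p = pcat (pcat a s) c"
      then have "parcs p = parcs a @ parcs s @ parcs c" by simp
      then show False using nf r(2) unfolding has_factor_in_def by (metis fst_conv image_eqI)
    qed
    then show "r (pmono1 p) = pmono1 p"
      by (simp add: r(1) basic_reduction_pmono1)
  qed
qed

end


section \<open>Left and right factorizations of ambiguities\<close>

context wf_digraph
begin

text \<open>Here \<open>C i\<close> is the position at which the factor \<open>u_i\<close> starts.
  Reducibility of \<open>u_i u_(i+1)\<close> supplies an occurrence, and irreducibility of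
  \<open>u_i\<close>, of \<open>u_(i+1)\<close> and of the products \<open>u_i d\<close> forces it
  to straddle the cut \<open>C (i + 1)\<close>, to end exactly at \<open>C (i + 2)\<close> and to be
  the earliest one.\<close>

lemma left_fact_chain:
  fixes R :: "('a, 'b, 'k::field) redsys"
  assumes rs: "reduction_system G R" and N: "N \<ge> 2" and hom: "\<And>s. s \<in> fst ` R \<Longrightarrow> plen s = N"
    and lf: "left_fact G R n us q"
  obtains C where "C 0 = 0" "C 1 = 1" "C (Suc n) = length (parcs q)"
    "\<forall>i\<le>n. C i \<le> C (Suc i)"
    "\<forall>i\<le>n. parcs (us ! i) = slice (C i) (C (Suc i)) (parcs q)"
    "\<forall>i<n. \<exists>k\<in>occurrences (parcs ` fst ` R) N (parcs q). C (i + 2) = k + N \<and> C i \<le> k \<and> k < C (i + 1)"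
    "\<forall>i<n. \<forall>k\<in>occurrences (parcs ` fst ` R) N (parcs q). C i \<le> k \<longrightarrow> C (i + 2) \<le> k + N"
proof -
  let ?W = "parcs ` fst ` R" and ?xs = "parcs q" and ?xss = "map parcs us"
  define P where "P = occurrences ?W N"
  define C where "C i = length (concat (take i ?xss))" for i
  have ne: "parcs s \<noteq> []" if "s \<in> fst ` R" for s
    using hom[OF that] N by (auto simp: plen_def)
  have W: "length w = N" if "w \<in> ?W" for w
    using that hom by (auto simp: plen_def)
  note irr = irred_path_iff[OF rs ne]
  have len: "length us = Suc n" and q: "?xs = concat ?xss" and link: "successively linked us"
    and u0: "us ! 0 \<in> paths_eq G 1" and ui: "\<And>i. 1 \<le> i \<Longrightarrow> i \<le> n \<Longrightarrow> us ! i \<in> irr_paths G R"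
    and red: "\<And>i. i < n \<Longrightarrow> \<not> irred_path G R (pcat (us ! i) (us ! Suc i))"
    and sub: "\<And>i d. i < n \<Longrightarrow> d \<in> paths G \<Longrightarrow> left_divisor G d (us ! Suc i) \<Longrightarrow> d \<noteq> us ! Suc i
      \<Longrightarrow> irred_path G R (pcat (us ! i) d)"
    using lf by (auto simp: left_fact_def)
  have up: "us ! i \<in> paths G" if "i \<le> n" for i
    using that u0 ui[of i] by (cases i) (auto simp: paths_eq_def irr_paths_def)
  have ll: "linked (us ! i) (us ! Suc i)" if "i < n" for i
    using link that len by (simp add: successively_conv_nth)
  have slice: "parcs (us ! i) = slice (C i) (C (Suc i)) ?xs" if "i \<le> n" for i
    using slice_concat[of i ?xss] that len unfolding C_def q by simp
  have mono: "C i \<le> C j" if "i \<le> j" for i j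
  proof -
    have "take j ?xss = take i ?xss @ take (j - i) (drop i ?xss)"
      using that take_add[of i "j - i" ?xss] by simp
    then show ?thesis unfolding C_def by (simp only: concat_append length_append le_add1)
  qed
  have C0: "C 0 = 0" and CL: "C (Suc n) = length ?xs"
    using len by (simp_all add: C_def q)
  have bd: "C i \<le> length ?xs" if "i \<le> Suc n" for i
    using mono[OF that] CL by simp
  have C1: "C 1 = 1"
    using u0 len unfolding C_def by (cases us) (auto simp: paths_eq_def plen_def)
  have R1: "\<exists>k\<in>P ?xs. C i \<le> k \<and> k + N \<le> C (i + 2)" if "i < n" for i
  proof -
    have "pcat (us ! i) (us ! Suc i) \<in> paths G"
      using pcat_in_paths[OF wf_digraph_axioms] up ll that by simp
    moreover have "parcs (pcat (us ! i) (us ! Suc i)) = slice (C i) (C (i + 2)) ?xs"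
      using that slice[of i] slice[of "Suc i"] mono[of i "Suc i"] mono[of "Suc i" "Suc (Suc i)"]
      by (simp add: slice_append)
    ultimately have "has_factor_in ?W (slice (C i) (C (i + 2)) ?xs)"
      using red[OF that] irr by metis
    then show ?thesis
      using has_factor_in_slice_iff[of ?W N "C i" "C (i + 2)" ?xs] W mono[of i "i + 2"] bd[of "i + 2"] that
      unfolding P_def by auto
  qed
  \<comment> \<open>If \<open>C (i + 1) \<le> m\<close>, the occurrence would lie in
    \<open>u_i d\<close>, where \<open>d\<close> is the proper left divisor of
    \<open>u_(i+1)\<close> that ends at \<open>m\<close>.\<close>
  have R2: "m < C (i + 1)" if "i < n" "k \<in> P ?xs" "C i \<le> k" "k + N \<le> m" "m < C (i + 2)" for i k m
  proof (rule ccontr)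
    assume m: "\<not> m < C (i + 1)"
    let ?v = "us ! Suc i"
    have v: "?v \<in> paths G" using up that by simp
    obtain d b where d: "d \<in> paths G" "b \<in> paths G" "linked d b" "?v = pcat d b" "parcs d = take (m - C (i + 1)) (parcs ?v)"
      using split_path2[OF v, of "take (m - C (i + 1)) (parcs ?v)" "drop (m - C (i + 1)) (parcs ?v)"]
      by (metis append_take_drop_id)
    have pd: "parcs d = slice (C (i + 1)) m ?xs"
      using d(5) slice[of "Suc i"] that m by (simp add: take_slice)
    have mb: "m \<le> length ?xs" using that bd[of "i + 2"] by simp
    have "length (parcs d) \<noteq> length (parcs ?v)"
      using slice[of "Suc i"] that m mb bd[of "i + 2"] by (simp add: pd length_slice)
    then have "d \<noteq> ?v" by auto
    moreover have "left_divisor G d ?v" using left_divisor_iff[OF d(1)] d by blast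
    ultimately have "irred_path G R (pcat (us ! i) d)" using sub that d by blast
    moreover have "linked (us ! i) d" using ll[OF that(1)] d(4) by simp
    then have "pcat (us ! i) d \<in> paths G"
      using pcat_in_paths[OF wf_digraph_axioms] up that d by simp
    moreover have "parcs (pcat (us ! i) d) = slice (C i) m ?xs"
      using that slice[of i] slice_append[of "C i" "C (Suc i)" m ?xs] mono[of i "Suc i"] m by (simp add: pd)
    ultimately have "\<not> has_factor_in ?W (slice (C i) m ?xs)" using irr by metis
    then show False
      using has_factor_in_slice_iff[of ?W N "C i" m ?xs] W mono[of i "Suc i"] m mb that
      unfolding P_def by auto
  qed
  \<comment> \<open>No occurrence fits into a single factor: \<open>u_0\<close> is one arrow and
    thus shorter than \<open>N\<close>, the other factors are irreducible.\<close>
  have R3: "\<not> k + N \<le> C (i + 1)" if "i \<le> n" "k \<in> P ?xs" "C i \<le> k" for i k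
  proof (cases "i = 0")
    case True
    then show ?thesis using C1 N by simp
  next
    case False
    then have "us ! i \<in> irr_paths G R" using ui that by simp
    then have "\<not> has_factor_in ?W (slice (C i) (C (i + 1)) ?xs)"
      using irr[of "us ! i"] slice[OF that(1)] by (simp add: irr_paths_def)
    then show ?thesis
      using has_factor_in_slice_iff[of ?W N "C i" "C (i + 1)" ?xs] W mono[of i "i + 1"] bd[of "i + 1"] that
      unfolding P_def by auto
  qed
  \<comment> \<open>An occurrence ending before \<open>C (i + 2)\<close> would, by \<open>R2\<close>
    at \<open>m = k + N\<close>, end before \<open>C (i + 1)\<close> and so lie inside
    \<open>u_i\<close>, against \<open>R3\<close>.\<close>
  have least: "C (i + 2) \<le> k + N" if "i < n" "k \<in> P ?xs" "C i \<le> k" for i k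
    using R2[of i k "k + N"] R3[of i k] that by force
  show ?thesis
  proof (rule that[of C])
    show "\<forall>i<n. \<exists>k\<in>occurrences ?W N ?xs. C (i + 2) = k + N \<and> C i \<le> k \<and> k < C (i + 1)"
    proof (intro allI impI)
      fix i assume i: "i < n"
      obtain k where k: "k \<in> P ?xs" "C i \<le> k" "k + N \<le> C (i + 2)" using R1[OF i] by blast
      then have "C (i + 2) = k + N" using least[OF i k(1,2)] by simp
      moreover have "k < C (i + 1)"
      proof (rule ccontr)
        assume "\<not> k < C (i + 1)"
        then have "\<not> k + N \<le> C (i + 1 + 1)" using R3[of "i + 1" k] k(1) i by simp
        then show False using k(3) by simp
      qed
      ultimately show "\<exists>k\<in>occurrences ?W N ?xs. C (i + 2) = k + N \<and> C i \<le> k \<and> k < C (i + 1)"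
        using k by (auto simp: P_def)
    qed
  qed (use C0 C1 CL mono slice least in \<open>auto simp: P_def\<close>)
qed

text \<open>The occurrence ending at \<open>C 2\<close> starts before \<open>C 1 = 1\<close>, hence
  at 0, so the first two factors together spell one left side. This is the bridge to degree 1, where
  ambiguities are defined by \<open>R\<close> and not by factorizations.\<close>

lemma left_fact_2:
  fixes R :: "('a, 'b, 'k::field) redsys"
  assumes rs: "reduction_system G R" and N: "N \<ge> 2" and hom: "\<And>s. s \<in> fst ` R \<Longrightarrow> plen s = N"
    and lf: "left_fact G R n us q" and n: "n \<ge> 1"
  shows "pcat (us ! 0) (us ! 1) \<in> fst ` R"
proof -
  obtain C where C: "C 0 = 0" "C 1 = 1" "C (Suc n) = length (parcs q)"
    "\<forall>i\<le>n. C i \<le> C (Suc i)"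
    "\<forall>i\<le>n. parcs (us ! i) = slice (C i) (C (Suc i)) (parcs q)"
    "\<forall>i<n. \<exists>k\<in>occurrences (parcs ` fst ` R) N (parcs q). C (i + 2) = k + N \<and> C i \<le> k \<and> k < C (i + 1)"
    "\<forall>i<n. \<forall>k\<in>occurrences (parcs ` fst ` R) N (parcs q). C i \<le> k \<longrightarrow> C (i + 2) \<le> k + N"
    by (rule left_fact_chain[OF rs N hom lf])
  have "0 < n" using n by simp
  from C(6)[rule_format, OF this] C(2) obtain k where "k \<in> occurrences (parcs ` fst ` R) N (parcs q)" "C (0 + 2) = k + N" "k = 0"
    by auto
  then have "slice (C 0) (C 2) (parcs q) \<in> parcs ` fst ` R"
    by (simp add: C(1) occurrences_def numeral_2_eq_2)
  then obtain s f where s: "(s, f) \<in> R" "slice (C 0) (C 2) (parcs q) = parcs s" by auto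
  have "parcs (pcat (us ! 0) (us ! 1)) = parcs s"
    using C(4)[rule_format, of 0] C(4)[rule_format, of 1] C(5)[rule_format, of 0] C(5)[rule_format, of 1] n s(2) slice_append[of "C 0" "C 1" "C 2" "parcs q"]
    by (simp add: numeral_2_eq_2)
  moreover have "pcat (us ! 0) (us ! 1) \<in> paths G"
    using lf n by (auto simp: left_fact_def paths_eq_def irr_paths_def successively_conv_nth
        intro!: pcat_in_paths[OF wf_digraph_axioms])
  moreover have "s \<in> paths G" using rs s(1) by (auto simp: reduction_system_def)
  moreover have "parcs s \<noteq> []" using hom[of s] s(1) N by (force simp: plen_def)
  ultimately have "pcat (us ! 0) (us ! 1) = s" using paths_eqI by metis
  then show ?thesis using s(1) by force
qed

text \<open>The factor \<open>v_i\<close> occupies the positions from \<open>D (i + 1)\<close> up to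
  \<open>D i\<close>. The occurrence at \<open>D (i + 2)\<close> makes \<open>v_(i+1) v_i\<close>
  reducible, its maximality makes the shortened products irreducible, and the overlap condition on
  \<open>D\<close> makes each \<open>v_i\<close> with \<open>i \<ge> 1\<close> irreducible.\<close>

lemma right_fact_exists:
  fixes R :: "('a, 'b, 'k::field) redsys"
  assumes rs: "reduction_system G R" and N: "N \<ge> 2" and hom: "\<And>s. s \<in> fst ` R \<Longrightarrow> plen s = N"
    and lf: "left_fact G R n us q" and n: "n \<ge> 1"
  obtains vs where "right_fact G R n vs q"
proof -
  let ?W = "parcs ` fst ` R" and ?xs = "parcs q"
  let ?P = "occurrences ?W N ?xs" and ?L = "length ?xs"
  have ne: "parcs s \<noteq> []" if "s \<in> fst ` R" for s
    using hom[OF that] N by (auto simp: plen_def)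
  have W: "length w = N" if "w \<in> ?W" for w
    using that hom by (auto simp: plen_def)
  note irr = irred_path_iff[OF rs ne]
  have q: "q \<in> paths G" using lf by (rule left_fact_in_paths)
  obtain C where C: "C 0 = 0" "C 1 = 1" "C (Suc n) = length (parcs q)"
    "\<forall>i\<le>n. C i \<le> C (Suc i)"
    "\<forall>i\<le>n. parcs (us ! i) = slice (C i) (C (Suc i)) (parcs q)"
    "\<forall>i<n. \<exists>k\<in>occurrences (parcs ` fst ` R) N (parcs q). C (i + 2) = k + N \<and> C i \<le> k \<and> k < C (i + 1)"
    "\<forall>i<n. \<forall>k\<in>occurrences (parcs ` fst ` R) N (parcs q). C i \<le> k \<longrightarrow> C (i + 2) \<le> k + N"
    by (rule left_fact_chain[OF rs N hom lf])
  obtain D where D: "D 0 = ?L" "D 1 = ?L - 1" "D (Suc n) = 0"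
    "\<forall>j<n. D (j + 2) \<in> ?P \<and> D (j + 2) + N \<le> D j \<and> D (j + 1) < D (j + 2) + N"
    "\<forall>j<n. \<forall>k\<in>?P. k + N \<le> D j \<longrightarrow> k \<le> D (j + 2)"
    by (rule dual_chain[OF n N C(2,3,6,7)])
  have dec: "D (Suc i) \<le> D i" if "i \<le> n" for i
  proof (cases i)
    case (Suc j)
    show ?thesis
    proof (cases j)
      case 0
      then show ?thesis using D(4)[rule_format, of 0] D(1,2) N n Suc by (auto simp: numeral_2_eq_2)
    next
      case (Suc l)
      \<comment> \<open>From \<open>D (l + 3) + N \<le> D (l + 1) < D (l + 2) + N\<close>.\<close>
      then show ?thesis using D(4)[rule_format, of l] D(4)[rule_format, of "Suc l"] that \<open>i = Suc j\<close> by simp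
    qed
  qed (use D in simp)
  have bd: "D i \<le> ?L" if "i \<le> Suc n" for i
    using that
  proof (induction i)
    case (Suc i)
    then show ?case using dec[of i] by simp
  qed (simp add: D(1))
  let ?pc = "\<lambda>i. slice (D (Suc i)) (D i) ?xs"
  have conc: "concat (map ?pc (rev [0..<Suc n])) = ?xs"
    using concat_rev_slices[of "Suc n" D ?xs] dec D(1,3) by (simp add: less_Suc_eq_le)
  have "map ?pc (rev [0..<Suc n]) \<noteq> []" by simp
  then obtain ps where ps: "map parcs ps = map ?pc (rev [0..<Suc n])" "set ps \<subseteq> paths G"
    "successively linked ps" "pprod ps = q"
    by (rule split_path[OF q conc[symmetric]])
  define vs where "vs = rev ps"
  have len: "length vs = Suc n"
    using arg_cong[OF ps(1), of length] by (simp add: vs_def)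
  have mp: "map parcs vs = map ?pc [0..<Suc n]"
    unfolding vs_def rev_map[symmetric] ps(1) by (simp add: rev_map)
  have pv: "parcs (vs ! i) = ?pc i" if "i \<le> n" for i
  proof -
    have "map parcs vs ! i = map ?pc [0..<Suc n] ! i" by (simp only: mp)
    then show ?thesis using that len by (simp del: upt_Suc)
  qed
  have vp: "vs ! i \<in> paths G" if "i \<le> n" for i
    using that ps(2) len nth_mem[of i vs] by (auto simp: vs_def)
  have lk: "linked (vs ! Suc i) (vs ! i)" if "i < n" for i
  proof -
    have "successively (\<lambda>x y. linked y x) vs" using ps(3) by (simp add: vs_def successively_rev)
    then show ?thesis using that len by (simp add: successively_conv_nth)
  qed
  have nofac: "\<not> has_factor_in ?W (slice m (D i) ?xs)" if "i < n" "D (i + 2) < m" "m \<le> D i" for i m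
    using has_factor_in_slice_iff[of ?W N m "D i" ?xs] W that bd[of i] D(5)[rule_format, of i] by force
  have "right_fact G R n vs q"
    unfolding right_fact_def
  proof (intro conjI ballI allI impI)
    show "length vs = Suc n" "successively linked (rev vs)" "q = pprod (rev vs)"
      using len ps by (simp_all add: vs_def)
    have "?L \<ge> 1" using D(4)[rule_format, of 0] D(1) N n by simp
    then show "vs ! 0 \<in> paths_eq G 1"
      using vp[of 0] pv[of 0] D(1,2) by (simp add: paths_eq_def plen_def length_slice)
    show "vs ! i \<in> irr_paths G R" if iN: "i \<in> {1..n}" for i
    proof -
      obtain j where j: "i = Suc j" "j < n" using iN by (cases i) auto
      \<comment> \<open>By maximality an occurrence inside \<open>v_i\<close> could only start at
        \<open>D (i + 1)\<close>, but the occurrence there extends beyond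
        \<open>D i\<close>.\<close>
      have "\<not> has_factor_in ?W (slice (D (i + 1)) (D i) ?xs)"
      proof
        assume "has_factor_in ?W (slice (D (i + 1)) (D i) ?xs)"
        then obtain k where k: "k \<in> ?P" "D (i + 1) \<le> k" "k + N \<le> D i"
          using has_factor_in_slice_iff[of ?W N "D (i + 1)" "D i" ?xs] W dec[of i] bd[of i] iN by auto
        have "k \<le> D (j + 2)" using D(5)[rule_format, OF j(2) k(1)] k(3) dec[of j] j by simp
        then show False using k D(4)[rule_format, OF j(2)] j by simp
      qed
      then show ?thesis using irr[of "vs ! i"] vp[of i] pv[of i] that by (simp add: irr_paths_def)
    qed
    fix i assume i: "i < n"
    have "has_factor_in ?W (slice (D (i + 2)) (D i) ?xs)"
      using has_factor_in_slice_iff[of ?W N "D (i + 2)" "D i" ?xs] W D(4)[rule_format, OF i] bd[of i] i by auto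
    moreover have "parcs (pcat (vs ! Suc i) (vs ! i)) = slice (D (i + 2)) (D i) ?xs"
      using pv[of i] pv[of "Suc i"] i dec[of i] dec[of "Suc i"]
      by (simp add: slice_append)
    moreover have "pcat (vs ! Suc i) (vs ! i) \<in> paths G"
      using vp[of i] vp[of "Suc i"] lk[OF i] i by (simp add: pcat_in_paths[OF wf_digraph_axioms])
    ultimately show "\<not> irred_path G R (pcat (vs ! Suc i) (vs ! i))"
      using irr by metis
    fix d assume d: "d \<in> paths G" "right_divisor G d (vs ! Suc i) \<and> d \<noteq> vs ! Suc i"
    then obtain a where a: "a \<in> paths G" "linked a d" "vs ! Suc i = pcat a d"
      using right_divisor_iff[OF d(1)] by blast
    \<comment> \<open>Properness of \<open>d\<close> means that \<open>a\<close> has an arrow, so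
      \<open>d\<close> starts strictly after \<open>D (i + 2)\<close>, where \<open>nofac\<close>
      applies.\<close>
    have "parcs a \<noteq> []"
    proof
      assume "parcs a = []"
      then have "pcat a d = d"
        using trivial_path[OF a(1)] a(2) by (intro path_eqI) (simp_all add: linked_def)
      then show False using d(2) a(3) by simp
    qed
    let ?m = "D (i + 2) + length (parcs a)"
    have al: "length (parcs a) + length (parcs d) = D (i + 1) - D (i + 2)"
      using arg_cong[OF pv[of "Suc i"], of length] a(3) i bd[of "Suc i"] by (simp add: length_slice)
    have m: "?m \<le> D (i + 1)" using al \<open>parcs a \<noteq> []\<close> by (cases "parcs a") auto
    have "parcs d = drop (length (parcs a)) (parcs (vs ! Suc i))" using a(3) by simp
    also have "\<dots> = slice ?m (D (i + 1)) ?xs"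
      using pv[of "Suc i"] i m by (simp add: drop_slice)
    finally have "parcs (pcat d (vs ! i)) = slice ?m (D i) ?xs"
      using pv[of i] i m dec[of i] by (simp add: slice_append)
    moreover have "linked d (vs ! i)" using lk[OF i] a(3) by simp
    then have "pcat d (vs ! i) \<in> paths G"
      using vp[of i] d i by (simp add: pcat_in_paths[OF wf_digraph_axioms])
    moreover have "\<not> has_factor_in ?W (slice ?m (D i) ?xs)"
      using nofac[OF i, of ?m] m dec[of i] i \<open>parcs a \<noteq> []\<close> by simp
    ultimately show "irred_path G R (pcat d (vs ! i))"
      using irr by metis
  qed
  then show ?thesis by (rule that)
qed

section \<open>Outer factors and truncations of ambiguities\<close>

lemma amb_subset_paths:
  assumes "reduction_system G R"
  shows "amb G R n \<subseteq> paths G"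
proof -
  have "q \<in> paths G" if "left_fact G R m us q" for m us q
    using that by (rule left_fact_in_paths)
  then show ?thesis
    using assms by (auto simp: amb_def paths_eq_def reduction_system_def)
qed

lemma left_fact_last:
  assumes lf: "left_fact G R n us q" and n: "n \<ge> 2"
  shows "us ! n \<in> paths G \<and> 1 \<le> plen (us ! n)"
proof -
  obtain m where m: "n = Suc m" "m \<ge> 1" using n by (cases n) auto
  have i: "us ! n \<in> irr_paths G R" "us ! m \<in> irr_paths G R" and l: "linked (us ! m) (us ! n)"
    and r: "\<not> irred_path G R (pcat (us ! m) (us ! n))"
    using lf m by (auto simp: left_fact_def successively_conv_nth)
  have "plen (us ! n) \<noteq> 0"
  proof
    assume "plen (us ! n) = 0"
    then have "pcat (us ! m) (us ! n) = us ! m"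
      using i l by (intro pcat_vertex_right) (auto simp: paths_eq_def irr_paths_def)
    then show False using r i by (simp add: irr_paths_def)
  qed
  then show ?thesis using i by (simp add: irr_paths_def)
qed

lemma right_fact_last:
  assumes rf: "right_fact G R n vs q" and n: "n \<ge> 2"
  shows "vs ! n \<in> paths G \<and> 1 \<le> plen (vs ! n)"
proof -
  obtain m where m: "n = Suc m" "m \<ge> 1" using n by (cases n) auto
  have i: "vs ! n \<in> irr_paths G R" "vs ! m \<in> irr_paths G R"
    and r: "\<not> irred_path G R (pcat (vs ! n) (vs ! m))"
    using rf m by (auto simp: right_fact_def)
  have "length vs = Suc n" "successively (\<lambda>x y. linked y x) vs"
    using rf by (auto simp: right_fact_def)
  then have l: "linked (vs ! n) (vs ! m)" using m by (simp add: successively_conv_nth)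
  have "plen (vs ! n) \<noteq> 0"
  proof
    assume "plen (vs ! n) = 0"
    then have "pcat (vs ! n) (vs ! m) = vs ! m"
      using i l by (intro pcat_vertex_left) (auto simp: paths_eq_def irr_paths_def)
    then show False using r i by (simp add: irr_paths_def)
  qed
  then show ?thesis using i by (simp add: irr_paths_def)
qed

text \<open>All conditions concern single or neighbouring factors and so survive truncation. The
  case \<open>n = 2\<close> is separate because it lands in degree 1, where \<open>amb\<close> is
  given by the left sides of the relations.\<close>

lemma left_fact_butlast_amb:
  fixes R :: "('a, 'b, 'k::field) redsys"
  assumes rs: "reduction_system G R" and N: "N \<ge> 2" and hom: "\<And>s. s \<in> fst ` R \<Longrightarrow> plen s = N"
    and lf: "left_fact G R n us q" and n: "n \<ge> 2"
  shows "pprod (take n us) \<in> amb G R (int n - 1)"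
proof (cases "n = 2")
  case True
  have "length us = 3" using lf True by (simp add: left_fact_def)
  then have "take n us = [us ! 0, us ! 1]"
    using True by (cases us; cases "tl us") (auto simp: numeral_2_eq_2)
  then have "pprod (take n us) = pcat (us ! 0) (us ! 1)" by (simp add: pprod_Cons pprod_single)
  then show ?thesis using left_fact_2[OF rs N hom lf] n True by (simp add: amb_def)
next
  case False
  then obtain m where m: "n = Suc m" "m \<ge> 2" using n by (cases n) auto
  have len: "length us = Suc n" using lf by (simp add: left_fact_def)
  have e: "take n us ! i = us ! i" if "i \<le> m" for i using that m by simp
  have "left_fact G R m (take n us) (pprod (take n us))"
    using lf len m e unfolding left_fact_def by (auto simp: successively_conv_nth)
  then show ?thesis using m by (auto simp: amb_def nat_diff_distrib)
qed

end


section \<open>Homogeneity\<close>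

text \<open>Homogeneity is expressed over all triples of a given length, so that membership in
  \<open>paths\<close> need not be tracked through reductions.\<close>

lemma pmono_homogeneous_iff:
  "pmono c p \<in> span_paths {p. plen p = L} \<longleftrightarrow> c = 0 \<or> plen p = L"
  by (auto simp: span_paths_def pmono_def)

lemma basic_reduction_homogeneous:
  assumes s: "plen s = N" and f: "f \<in> span_paths {p. plen p = N}" and x: "x \<in> span_paths {p. plen p = L}"
  shows "basic_reduction a s f c x \<in> span_paths {p. plen p = L}"
  unfolding basic_reduction_def
proof (intro span_paths_sum)
  fix q assume "q \<in> Poly_Mapping.keys x"
  then have q: "plen q = L" using x by (auto simp: span_paths_def)
  have "kq_mult (kq_mult (pmono d a) f) (pmono1 c) \<in> span_paths {p. plen p = L}"
    if "q = pcat (pcat a s) c" for d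
  proof -
    have "kq_mult (pmono d a) f \<in> span_paths {p. plen p = plen a + N}"
      by (rule kq_mult_in_span[OF _ f, of _ "{p. plen p = plen a}"]) (auto simp: pmono_homogeneous_iff)
    then show ?thesis
      by (rule kq_mult_in_span[of _ _ _ "{p. plen p = plen c}"])
        (use that q s in \<open>auto simp: pmono_homogeneous_iff\<close>)
  qed
  then show "(if q = pcat (pcat a s) c
      then kq_mult (kq_mult (pmono (Poly_Mapping.lookup x q) a) f) (pmono1 c)
      else pmono (Poly_Mapping.lookup x q) q) \<in> span_paths {p. plen p = L}"
    using q by (simp add: pmono_homogeneous_iff)
qed

lemma reduction_homogeneous:
  assumes R: "\<And>s f. (s, f) \<in> R \<Longrightarrow> plen s = N \<and> f \<in> span_paths {p. plen p = N}"
    and r: "r \<in> reductions Q R" and x: "x \<in> span_paths {p. plen p = L}"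
  shows "r x \<in> span_paths {p. plen p = L}"
proof -
  have "foldr (\<circ>) rs id x \<in> span_paths {p. plen p = L}" if "set rs \<subseteq> basic_reductions Q R" for rs
    using that
  proof (induction rs)
    case (Cons r rs)
    then obtain a s f c where "r = basic_reduction a s f c" "(s, f) \<in> R"
      by (auto simp: basic_reductions_def)
    then show ?case
      using Cons R[of s f] by (simp add: basic_reduction_homogeneous)
  qed (simp add: x)
  then show ?thesis using r by (auto simp: reductions_def)
qed

text \<open>In the step case \<open>p\<close> does not occur in \<open>x\<close>, so its coefficient
  cannot cancel and \<open>p\<close> lies in the support of a reduct of \<open>q\<close>. The zero
  element is homogeneous of every length.\<close>

lemma preceq_homogeneous:
  assumes R: "\<And>s f. (s, f) \<in> R \<Longrightarrow> plen s = N \<and> f \<in> span_paths {p. plen p = N}"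
    and "preceq Q R x y" "y \<in> span_paths {p. plen p = L}"
  shows "x \<in> span_paths {p. plen p = L}"
  using assms(2,3)
proof (induction rule: preceq.induct)
  case (step l m p q r x)
  have "r (pmono m q) \<in> span_paths {p. plen p = L}"
    using reduction_homogeneous[OF R step.hyps(5)] step.prems by blast
  moreover have "p \<in> Poly_Mapping.keys (r (pmono m q))"
    using step.hyps by (simp add: in_keys_iff lookup_add pmono_def)
  ultimately show ?case by (auto simp: span_paths_def pmono_def)
qed simp_all


section \<open>The tensor products and their radicals\<close>

definition arrow_ideal :: "('v, 'a) pre_digraph \<Rightarrow> ('v, 'a, 'k::field) kq set \<Rightarrow> ('v, 'a, 'k) kq set set" where
  "arrow_ideal Q I = proj Q I ` span_paths (paths_ge Q 1)"

locale quiver_quotient = wf_digraph Q for Q :: "('v, 'a) pre_digraph" +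
  fixes I :: "('v, 'a, 'k::field) kq set"
  assumes finite_verts: "finite (verts Q)" and ideal_I: "ideal I (path_algebra Q)"
begin

abbreviation "A \<equiv> quot_alg Q I"
abbreviation "\<pi> \<equiv> proj Q I"
abbreviation "J \<equiv> arrow_ideal Q I"

sublocale A: ring A
  by (simp add: quot_alg_def ideal.quotient_is_ring[OF ideal_I])

lemma proj_hom: "\<pi> \<in> ring_hom (path_algebra Q) A"
proof -
  have "\<pi> = (+>\<^bsub>path_algebra Q\<^esub>) I" by (simp add: fun_eq_iff proj_def)
  then show ?thesis using ideal.rcos_ring_hom[OF ideal_I] by (simp add: quot_alg_def)
qed

lemma proj_closed [simp]: "x \<in> span_paths (paths Q) \<Longrightarrow> \<pi> x \<in> carrier A"
  using ring_hom_closed[OF proj_hom] by (simp add: path_algebra_def)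

lemma proj_mult:
  "x \<in> span_paths (paths Q) \<Longrightarrow> y \<in> span_paths (paths Q) \<Longrightarrow> \<pi> (kq_mult x y) = \<pi> x \<otimes>\<^bsub>A\<^esub> \<pi> y"
  using ring_hom_mult[OF proj_hom, of x y] by (simp add: path_algebra_def)

lemma proj_surj: "\<pi> ` span_paths (paths Q) = carrier A"
  by (auto simp: quot_alg_def FactRing_def A_RCOSETS_def RCOSETS_def proj_def a_r_coset_def path_algebra_def)

lemma J_subset: "J \<subseteq> carrier A"
  by (auto simp: arrow_ideal_def intro: proj_closed span_paths_ge)

lemma J_mult_left:
  assumes "a \<in> carrier A" "j \<in> J"
  shows "a \<otimes>\<^bsub>A\<^esub> j \<in> J"
proof -
  obtain x y where x: "x \<in> span_paths (paths Q)" "a = \<pi> x" and y: "y \<in> span_paths (paths_ge Q 1)" "j = \<pi> y"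
    using assms unfolding arrow_ideal_def proj_surj[symmetric] by blast
  have "y \<in> span_paths (paths Q)" using y(1) by (rule span_paths_ge)
  then have "a \<otimes>\<^bsub>A\<^esub> j = \<pi> (kq_mult x y)" using x y by (simp add: proj_mult)
  moreover have "kq_mult x y \<in> span_paths (paths_ge Q 1)"
    by (rule kq_mult_in_span[OF x(1) y(1)]) (auto simp: paths_ge_iff pcat_in_paths[OF wf_digraph_axioms])
  ultimately show ?thesis by (simp add: arrow_ideal_def)
qed

lemma J_mult_right:
  assumes "a \<in> carrier A" "j \<in> J"
  shows "j \<otimes>\<^bsub>A\<^esub> a \<in> J"
proof -
  obtain x y where x: "x \<in> span_paths (paths Q)" "a = \<pi> x" and y: "y \<in> span_paths (paths_ge Q 1)" "j = \<pi> y"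
    using assms unfolding arrow_ideal_def proj_surj[symmetric] by blast
  have "y \<in> span_paths (paths Q)" using y(1) by (rule span_paths_ge)
  then have "j \<otimes>\<^bsub>A\<^esub> a = \<pi> (kq_mult y x)" using x y by (simp add: proj_mult)
  moreover have "kq_mult y x \<in> span_paths (paths_ge Q 1)"
    by (rule kq_mult_in_span[OF y(1) x(1)]) (auto simp: paths_ge_iff pcat_in_paths[OF wf_digraph_axioms])
  ultimately show ?thesis by (simp add: arrow_ideal_def)
qed

lemma kq_const_in_E: "kq_const Q c \<in> span_paths (paths_eq Q 0)"
  unfolding kq_const_def
  by (intro span_paths_sum pmono_in_span) (simp add: paths_eq_def plen_def vertex_paths[OF wf_digraph_axioms])

lemma E_subset: "e \<in> span_paths (paths_eq Q 0) \<Longrightarrow> e \<in> span_paths (paths Q)"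
  by (auto simp: span_paths_def paths_eq_def)

end

section \<open>Additive structure of the tensor product and its two actions\<close>

locale quiver_tensor = quiver_quotient Q I for Q :: "('v, 'a) pre_digraph" and I :: "('v, 'a, 'k::field) kq set" +
  fixes X :: "('v, 'a) path set"
  assumes X_paths: "X \<subseteq> paths Q"
begin

abbreviation "S \<equiv> carrier A \<times> (span_paths X :: ('v, 'a, 'k) kq set) \<times> carrier A"
abbreviation "F \<equiv> tens_free Q I X"
abbreviation "M \<equiv> tensor_bimodule Q I X"
abbreviation "cls \<equiv> tens_class Q I X"
abbreviation "lact a \<equiv> frag_extend (\<lambda>(b, x, c). frag_of (a \<otimes>\<^bsub>A\<^esub> b, x :: ('v, 'a, 'k) kq, c))"
abbreviation "ract a \<equiv> frag_extend (\<lambda>(b, x, c). frag_of (b, x :: ('v, 'a, 'k) kq, c \<otimes>\<^bsub>A\<^esub> a))"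

sublocale F: comm_group F
  rewrites "x \<otimes>\<^bsub>F\<^esub> y = x + y" and "\<one>\<^bsub>F\<^esub> = 0"
  by (simp_all add: tens_free_def abelian_free_Abelian_group)

lemma F_simps [simp]: "x \<otimes>\<^bsub>F\<^esub> y = x + y" "\<one>\<^bsub>F\<^esub> = 0"
  by (simp_all add: tens_free_def)

lemma carrier_F: "\<xi> \<in> carrier F \<longleftrightarrow> Poly_Mapping.keys \<xi> \<subseteq> S"
  by (simp add: tens_free_def)

lemma frag_of_in_F: "frag_of g \<in> carrier F \<longleftrightarrow> g \<in> S"
  by (simp add: carrier_F)

lemma diff_in_F: "x \<in> carrier F \<Longrightarrow> y \<in> carrier F \<Longrightarrow> x - y \<in> carrier F"
  using keys_diff[of x y] by (auto simp: carrier_F)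

lemma F_diff: "y \<in> carrier F \<Longrightarrow> x - y = x \<otimes>\<^bsub>F\<^esub> inv\<^bsub>F\<^esub> y"
  by (simp add: tens_free_def)

lemma E_mult_left: "e \<in> span_paths (paths_eq Q 0) \<Longrightarrow> x \<in> span_paths X \<Longrightarrow> kq_mult e x \<in> span_paths X"
  by (erule (1) kq_mult_in_span) (simp add: pcat_vertex_left)

lemma E_mult_right: "e \<in> span_paths (paths_eq Q 0) \<Longrightarrow> x \<in> span_paths X \<Longrightarrow> kq_mult x e \<in> span_paths X"
  by (rule kq_mult_in_span) (auto simp: pcat_vertex_right)

lemma rels_subset: "tens_rels Q I X \<subseteq> carrier F"
  unfolding tens_rels_def Let_def
  by (auto intro!: diff_in_F simp: frag_of_in_F span_paths_add E_mult_left E_mult_right E_subset)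

sublocale sub: normal "tens_sub Q I X" F
  unfolding F.normal_iff_subgroup tens_sub_def
  by (rule F.generate_is_subgroup[OF rels_subset])

lemma M_simps:
  "carrier M = carrier (F Mod tens_sub Q I X)" "ring.add M = mult (F Mod tens_sub Q I X)"
  "ring.zero M = one (F Mod tens_sub Q I X)"
  by (simp_all add: tensor_bimodule_def Let_def)

sublocale M: abelian_group M
proof -
  interpret G: comm_group "F Mod tens_sub Q I X"
    using sub.subgroup_axioms by (rule F.abelian_FactGroup)
  show "abelian_group M"
  proof (rule abelian_groupI)
    show "\<exists>y\<in>carrier M. y \<oplus>\<^bsub>M\<^esub> x = \<zero>\<^bsub>M\<^esub>" if "x \<in> carrier M" for x
      using that unfolding M_simps by (rule G.l_inv_ex)
  qed (unfold M_simps, (erule (2) G.m_assoc | erule (1) G.m_closed | rule G.one_closed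
        | erule (1) G.m_comm | erule G.l_one)+)
qed

sublocale cls: group_hom F "add_monoid M" cls
proof -
  have "cls = (\<lambda>a. tens_sub Q I X #>\<^bsub>F\<^esub> a)" by (simp add: fun_eq_iff tens_class_def)
  then have "cls \<in> hom F (add_monoid M)" using sub.r_coset_hom_Mod by (simp add: hom_def M_simps)
  then show "group_hom F (add_monoid M) cls"
    by (simp add: group_hom_def group_hom_axioms_def M.a_group)
qed

lemma carrier_M: "carrier M = cls ` carrier F"
  by (auto simp: tensor_bimodule_def Let_def FactGroup_def RCOSETS_def tens_class_def)

lemma cls_closed [simp]: "\<xi> \<in> carrier F \<Longrightarrow> cls \<xi> \<in> carrier M"
  using cls.hom_closed by simp

lemma cls_add: "\<xi> \<in> carrier F \<Longrightarrow> \<eta> \<in> carrier F \<Longrightarrow> cls (\<xi> + \<eta>) = cls \<xi> \<oplus>\<^bsub>M\<^esub> cls \<eta>"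
  using cls.hom_mult[of \<xi> \<eta>] by simp

lemma cls_sub: "\<xi> \<in> tens_sub Q I X \<Longrightarrow> cls \<xi> = \<zero>\<^bsub>M\<^esub>"
  unfolding tens_class_def
  using F.coset_join2[OF _ sub.subgroup_axioms] sub.subset
  by (auto simp: tensor_bimodule_def Let_def FactGroup_def)

lemma cls_eqI: "\<xi> \<in> carrier F \<Longrightarrow> \<eta> \<in> carrier F \<Longrightarrow> \<xi> - \<eta> \<in> tens_sub Q I X \<Longrightarrow> cls \<xi> = cls \<eta>"
  using cls_sub[of "\<xi> - \<eta>"] cls_add[of "\<xi> - \<eta>" \<eta>] diff_in_F[of \<xi> \<eta>] by simp

text \<open>Well-definedness of the actions: they are unions over all representatives of a coset,
  and the united classes coincide once \<open>f\<close> preserves the subgroup of relations.\<close>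

lemma UN_cls:
  assumes \<xi>: "\<xi> \<in> carrier F" and add: "\<And>x y. f (x + y) = f x + f y"
    and cl: "\<And>x. x \<in> carrier F \<Longrightarrow> f x \<in> carrier F"
    and sb: "\<And>x. x \<in> tens_sub Q I X \<Longrightarrow> f x \<in> tens_sub Q I X"
  shows "(\<Union>\<eta>\<in>cls \<xi>. cls (f \<eta>)) = cls (f \<xi>)"
proof -
  have "cls (f \<eta>) = cls (f \<xi>)" if \<eta>: "\<eta> \<in> cls \<xi>" for \<eta>
  proof -
    obtain h where h: "h \<in> tens_sub Q I X" "\<eta> = h + \<xi>"
      using \<eta> by (auto simp: tens_class_def r_coset_def)
    have "f h \<in> tens_sub Q I X" "h \<in> carrier F" using sb h(1) sub.subset by auto
    then show ?thesis using h(2) add cl \<xi> cls_add[of "f h" "f \<xi>"] cls_sub[of "f h"] by simp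
  qed
  moreover have "\<xi> \<in> cls \<xi>"
    unfolding tens_class_def using F.rcos_self[OF \<xi> sub.subgroup_axioms] by simp
  ultimately show ?thesis by blast
qed

lemma frag_extend_hom:
  assumes "\<And>g. g \<in> S \<Longrightarrow> f g \<in> S"
  shows "group_hom F F (frag_extend (\<lambda>g. frag_of (f g)))"
proof -
  have "frag_extend (\<lambda>g. frag_of (f g)) \<xi> \<in> carrier F" if "\<xi> \<in> carrier F" for \<xi>
  proof -
    have "Poly_Mapping.keys (frag_extend (\<lambda>g. frag_of (f g)) \<xi>) \<subseteq> f ` Poly_Mapping.keys \<xi>"
      using keys_frag_extend[of "\<lambda>g. frag_of (f g)" \<xi>] by auto
    moreover have "f ` Poly_Mapping.keys \<xi> \<subseteq> S"
      using that assms unfolding carrier_F by blast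
    ultimately show ?thesis unfolding carrier_F by (rule order_trans)
  qed
  then show ?thesis
    by (auto simp: group_hom_def group_hom_axioms_def hom_def frag_extend_add)
qed

text \<open>Serves each action twice: with the defining relations as \<open>B\<close> it gives
  well-definedness, with \<open>rad_gens\<close> as \<open>B\<close> stability of the
  radical.\<close>

lemma frag_extend_generate:
  assumes "\<And>g. g \<in> S \<Longrightarrow> f g \<in> S" "B \<subseteq> carrier F"
    and "\<And>b. b \<in> B \<Longrightarrow> frag_extend (\<lambda>g. frag_of (f g)) b \<in> B" "x \<in> generate F B"
  shows "frag_extend (\<lambda>g. frag_of (f g)) x \<in> generate F B"
proof -
  let ?h = "frag_extend (\<lambda>g. frag_of (f g))"
  have "?h ` generate F B = generate F (?h ` B)"
    using group_hom.generate_img[OF frag_extend_hom[OF assms(1)] assms(2)] by simp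
  also have "\<dots> \<subseteq> generate F B"
    using assms(3) by (intro F.mono_generate) auto
  finally show ?thesis using assms(4) by blast
qed

text \<open>Presents the actions as induced by maps of generators, the form required by
  \<open>frag_extend_hom\<close> and \<open>frag_extend_generate\<close>.\<close>

lemma split_frag: "(\<lambda>(b, x, c). frag_of (g b x c)) = (\<lambda>t. frag_of (case t of (b, x, c) \<Rightarrow> g b x c))"
  by (auto simp: fun_eq_iff)

lemma rels_intros:
  shows "\<lbrakk>a \<in> carrier A; a' \<in> carrier A; x \<in> span_paths X; b \<in> carrier A\<rbrakk> \<Longrightarrow> frag_of (a \<oplus>\<^bsub>A\<^esub> a', x, b) - frag_of (a, x, b) - frag_of (a', x, b) \<in> tens_rels Q I X"
  and "\<lbrakk>a \<in> carrier A; x \<in> span_paths X; x' \<in> span_paths X; b \<in> carrier A\<rbrakk> \<Longrightarrow> frag_of (a, x + x', b) - frag_of (a, x, b) - frag_of (a, x', b) \<in> tens_rels Q I X"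
  and "\<lbrakk>a \<in> carrier A; x \<in> span_paths X; b \<in> carrier A; b' \<in> carrier A\<rbrakk> \<Longrightarrow> frag_of (a, x, b \<oplus>\<^bsub>A\<^esub> b') - frag_of (a, x, b) - frag_of (a, x, b') \<in> tens_rels Q I X"
  and "\<lbrakk>a \<in> carrier A; e \<in> span_paths (paths_eq Q 0); x \<in> span_paths X; b \<in> carrier A\<rbrakk> \<Longrightarrow> frag_of (a \<otimes>\<^bsub>A\<^esub> \<pi> e, x, b) - frag_of (a, kq_mult e x, b) \<in> tens_rels Q I X"
  and "\<lbrakk>a \<in> carrier A; x \<in> span_paths X; e \<in> span_paths (paths_eq Q 0); b \<in> carrier A\<rbrakk> \<Longrightarrow> frag_of (a, kq_mult x e, b) - frag_of (a, x, \<pi> e \<otimes>\<^bsub>A\<^esub> b) \<in> tens_rels Q I X"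
  unfolding tens_rels_def Let_def by blast+

lemma rels_cases:
  assumes "r \<in> tens_rels Q I X"
  obtains (add_left) a a' x b where "a \<in> carrier A" "a' \<in> carrier A" "x \<in> span_paths X" "b \<in> carrier A" "r = frag_of (a \<oplus>\<^bsub>A\<^esub> a', x, b) - frag_of (a, x, b) - frag_of (a', x, b)"
  | (add_mid) a x x' b where "a \<in> carrier A" "x \<in> span_paths X" "x' \<in> span_paths X" "b \<in> carrier A" "r = frag_of (a, x + x', b) - frag_of (a, x, b) - frag_of (a, x', b)"
  | (add_right) a x b b' where "a \<in> carrier A" "x \<in> span_paths X" "b \<in> carrier A" "b' \<in> carrier A" "r = frag_of (a, x, b \<oplus>\<^bsub>A\<^esub> b') - frag_of (a, x, b) - frag_of (a, x, b')"
  | (balance_left) a e x b where "a \<in> carrier A" "e \<in> span_paths (paths_eq Q 0)" "x \<in> span_paths X" "b \<in> carrier A" "r = frag_of (a \<otimes>\<^bsub>A\<^esub> \<pi> e, x, b) - frag_of (a, kq_mult e x, b)"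
  | (balance_right) a x e b where "a \<in> carrier A" "x \<in> span_paths X" "e \<in> span_paths (paths_eq Q 0)" "b \<in> carrier A" "r = frag_of (a, kq_mult x e, b) - frag_of (a, x, \<pi> e \<otimes>\<^bsub>A\<^esub> b)"
  using assms unfolding tens_rels_def Let_def
  by (elim UnE CollectE exE conjE) (rule that; assumption)+

text \<open>Only the left outer factor changes, so each of the five families is mapped to itself, by
  distributivity for sums in that factor and by associativity for balancing on the left.\<close>

lemma lact_rels:
  assumes a: "c \<in> carrier A" and r: "r \<in> tens_rels Q I X"
  shows "lact c r \<in> tens_rels Q I X"
  using r
proof (cases rule: rels_cases)
  case (add_left a a' x b)
  then show ?thesis
    using a rels_intros(1)[of "c \<otimes>\<^bsub>A\<^esub> a" "c \<otimes>\<^bsub>A\<^esub> a'" x b]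
    by (simp add: frag_extend_diff A.r_distr A.m_assoc E_subset)
next
  case (add_mid a x x' b)
  then show ?thesis
    using a rels_intros(2)[of "c \<otimes>\<^bsub>A\<^esub> a" x x' b]
    by (simp add: frag_extend_diff A.r_distr A.m_assoc E_subset)
next
  case (add_right a x b b')
  then show ?thesis
    using a rels_intros(3)[of "c \<otimes>\<^bsub>A\<^esub> a" x b b']
    by (simp add: frag_extend_diff A.r_distr A.m_assoc E_subset)
next
  case (balance_left a e x b)
  then show ?thesis
    using a rels_intros(4)[of "c \<otimes>\<^bsub>A\<^esub> a" e x b]
    by (simp add: frag_extend_diff A.r_distr A.m_assoc E_subset)
next
  case (balance_right a x e b)
  then show ?thesis
    using a rels_intros(5)[of "c \<otimes>\<^bsub>A\<^esub> a" x e b]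
    by (simp add: frag_extend_diff A.r_distr A.m_assoc E_subset)
qed

lemma ract_rels:
  assumes a: "c \<in> carrier A" and r: "r \<in> tens_rels Q I X"
  shows "ract c r \<in> tens_rels Q I X"
  using r
proof (cases rule: rels_cases)
  case (add_left a a' x b)
  then show ?thesis
    using a rels_intros(1)[of a a' x "b \<otimes>\<^bsub>A\<^esub> c"]
    by (simp add: frag_extend_diff A.l_distr A.m_assoc E_subset)
next
  case (add_mid a x x' b)
  then show ?thesis
    using a rels_intros(2)[of a x x' "b \<otimes>\<^bsub>A\<^esub> c"]
    by (simp add: frag_extend_diff A.l_distr A.m_assoc E_subset)
next
  case (add_right a x b b')
  then show ?thesis
    using a rels_intros(3)[of a x "b \<otimes>\<^bsub>A\<^esub> c" "b' \<otimes>\<^bsub>A\<^esub> c"]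
    by (simp add: frag_extend_diff A.l_distr A.m_assoc E_subset)
next
  case (balance_left a e x b)
  then show ?thesis
    using a rels_intros(4)[of a e x "b \<otimes>\<^bsub>A\<^esub> c"]
    by (simp add: frag_extend_diff A.l_distr A.m_assoc E_subset)
next
  case (balance_right a x e b)
  then show ?thesis
    using a rels_intros(5)[of a x e "b \<otimes>\<^bsub>A\<^esub> c"]
    by (simp add: frag_extend_diff A.l_distr A.m_assoc E_subset)
qed

lemma lact_closed: "a \<in> carrier A \<Longrightarrow> \<xi> \<in> carrier F \<Longrightarrow> lact a \<xi> \<in> carrier F"
  unfolding split_frag by (rule group_hom.hom_closed[OF frag_extend_hom]) auto

lemma ract_closed: "a \<in> carrier A \<Longrightarrow> \<xi> \<in> carrier F \<Longrightarrow> ract a \<xi> \<in> carrier F"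
  unfolding split_frag by (rule group_hom.hom_closed[OF frag_extend_hom]) auto

lemma smult_cls:
  assumes "a \<in> carrier A" "\<xi> \<in> carrier F"
  shows "a \<odot>\<^bsub>M\<^esub> cls \<xi> = cls (lact a \<xi>)"
proof -
  have "a \<odot>\<^bsub>M\<^esub> cls \<xi> = (\<Union>\<eta>\<in>cls \<xi>. cls (lact a \<eta>))"
    by (simp add: tensor_bimodule_def Let_def)
  also have "\<dots> = cls (lact a \<xi>)"
  proof (rule UN_cls[OF assms(2)])
    show "lact a x \<in> tens_sub Q I X" if "x \<in> tens_sub Q I X" for x
      using that lact_rels[OF assms(1)] rels_subset assms(1) unfolding tens_sub_def split_frag
      by (intro frag_extend_generate) auto
  qed (use assms lact_closed frag_extend_add in auto)
  finally show ?thesis .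
qed

lemma rsmult_cls:
  assumes "a \<in> carrier A" "\<xi> \<in> carrier F"
  shows "rsmult M (cls \<xi>) a = cls (ract a \<xi>)"
proof -
  have "rsmult M (cls \<xi>) a = (\<Union>\<eta>\<in>cls \<xi>. cls (ract a \<eta>))"
    by (simp add: tensor_bimodule_def Let_def)
  also have "\<dots> = cls (ract a \<xi>)"
  proof (rule UN_cls[OF assms(2)])
    show "ract a x \<in> tens_sub Q I X" if "x \<in> tens_sub Q I X" for x
      using that ract_rels[OF assms(1)] rels_subset assms(1) unfolding tens_sub_def split_frag
      by (intro frag_extend_generate) auto
  qed (use assms ract_closed frag_extend_add in auto)
  finally show ?thesis .
qed


section \<open>The radical, described on representatives\<close>

definition rad_gens :: "(('v, 'a, 'k) tgen \<Rightarrow>\<^sub>0 int) set" where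
  "rad_gens = {frag_of (a, x, b) | a x b. (a, x, b) \<in> S \<and> (a \<in> J \<or> b \<in> J)}"

lemma rad_gensI:
  "a \<in> carrier A \<Longrightarrow> x \<in> span_paths X \<Longrightarrow> b \<in> carrier A \<Longrightarrow> a \<in> J \<or> b \<in> J \<Longrightarrow> frag_of (a, x, b) \<in> rad_gens"
  unfolding rad_gens_def by blast

lemma rad_gens_lact: "c \<in> carrier A \<Longrightarrow> r \<in> rad_gens \<Longrightarrow> lact c r \<in> rad_gens"
  by (subst (asm) rad_gens_def) (force intro: rad_gensI J_mult_left)

lemma rad_gens_ract: "c \<in> carrier A \<Longrightarrow> r \<in> rad_gens \<Longrightarrow> ract c r \<in> rad_gens"
  by (subst (asm) rad_gens_def) (force intro: rad_gensI J_mult_right)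

text \<open>A single generating set covers both summands of the radical, which makes stability under
  the left and the right action a check on generators. Inclusion in \<open>rad_part\<close> is what
  minimality asks for.\<close>

definition Rad :: "('v, 'a, 'k) tens set" where
  "Rad = cls ` generate F rad_gens"

lemma rad_gens_subset: "rad_gens \<subseteq> carrier F"
  by (auto simp: rad_gens_def frag_of_in_F)

lemma generate_rad_gens: "\<xi> \<in> generate F rad_gens \<Longrightarrow> \<xi> \<in> carrier F"
  using F.generate_incl[OF rad_gens_subset] by blast

lemma Rad_subgroup: "subgroup Rad (add_monoid M)"
  unfolding Rad_def by (rule cls.subgroup_img_is_subgroup[OF F.generate_is_subgroup[OF rad_gens_subset]])

lemma Rad_smult:
  assumes "a \<in> carrier A" "x \<in> Rad"
  shows "a \<odot>\<^bsub>M\<^esub> x \<in> Rad"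
proof -
  obtain \<xi> where \<xi>: "\<xi> \<in> generate F rad_gens" "x = cls \<xi>" using assms by (auto simp: Rad_def)
  have "lact a \<xi> \<in> generate F rad_gens"
    using \<xi>(1) assms(1) rad_gens_subset rad_gens_lact unfolding split_frag
    by (intro frag_extend_generate) auto
  then show ?thesis using \<xi> assms(1) by (simp add: smult_cls generate_rad_gens Rad_def)
qed

lemma Rad_rsmult:
  assumes "a \<in> carrier A" "x \<in> Rad"
  shows "rsmult M x a \<in> Rad"
proof -
  obtain \<xi> where \<xi>: "\<xi> \<in> generate F rad_gens" "x = cls \<xi>" using assms by (auto simp: Rad_def)
  have "ract a \<xi> \<in> generate F rad_gens"
    using \<xi>(1) assms(1) rad_gens_subset rad_gens_ract unfolding split_frag
    by (intro frag_extend_generate) auto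
  then show ?thesis using \<xi> assms(1) by (simp add: rsmult_cls generate_rad_gens Rad_def)
qed

lemma smult_closed: "a \<in> carrier A \<Longrightarrow> x \<in> carrier M \<Longrightarrow> a \<odot>\<^bsub>M\<^esub> x \<in> carrier M"
  by (auto simp: carrier_M smult_cls intro!: imageI lact_closed)

lemma rsmult_closed: "a \<in> carrier A \<Longrightarrow> x \<in> carrier M \<Longrightarrow> rsmult M x a \<in> carrier M"
  by (auto simp: carrier_M rsmult_cls intro!: imageI ract_closed)

text \<open>A generator with \<open>a\<close> in \<open>J\<close> is \<open>a\<close> acting on
  \<open>1 \<otimes> x \<otimes> b\<close>; otherwise \<open>b\<close> is in \<open>J\<close> and
  acts from the right on \<open>a \<otimes> x \<otimes> 1\<close>.\<close>

lemma Rad_subset_rad_part: "Rad \<subseteq> rad_part Q I M"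
proof -
  let ?G1 = "{j \<odot>\<^bsub>M\<^esub> x | j x. j \<in> J \<and> x \<in> carrier M}"
  let ?G2 = "{rsmult M x j | j x. j \<in> J \<and> x \<in> carrier M}"
  let ?H1 = "generate (add_monoid M) ?G1" and ?H2 = "generate (add_monoid M) ?G2"
  have sg: "?G1 \<subseteq> carrier (add_monoid M)" "?G2 \<subseteq> carrier (add_monoid M)"
    using smult_closed rsmult_closed J_subset by auto
  have H: "subgroup ?H1 (add_monoid M)" "subgroup ?H2 (add_monoid M)"
    using group.generate_is_subgroup[OF M.a_group] sg by blast+
  have rp: "rad_part Q I M = ?H1 <#>\<^bsub>add_monoid M\<^esub> ?H2"
    by (simp add: rad_part_def Let_def arrow_ideal_def set_add_def)
  have H1: "x \<in> rad_part Q I M" if "x \<in> ?H1" for x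
  proof -
    have "x = x \<otimes>\<^bsub>add_monoid M\<^esub> \<one>\<^bsub>add_monoid M\<^esub>"
      using that group.generate_incl[OF M.a_group sg(1)] by auto
    then show ?thesis using that subgroup.one_closed[OF H(2)] unfolding rp set_mult_def by blast
  qed
  have H2: "x \<in> rad_part Q I M" if "x \<in> ?H2" for x
  proof -
    have "x = \<one>\<^bsub>add_monoid M\<^esub> \<otimes>\<^bsub>add_monoid M\<^esub> x"
      using that group.generate_incl[OF M.a_group sg(2)] by auto
    then show ?thesis using that subgroup.one_closed[OF H(1)] unfolding rp set_mult_def by blast
  qed
  have "cls ` rad_gens \<subseteq> rad_part Q I M"
  proof
    fix y assume "y \<in> cls ` rad_gens"
    then obtain a x b where *: "a \<in> carrier A" "x \<in> span_paths X" "b \<in> carrier A" "a \<in> J \<or> b \<in> J"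
      "y = cls (frag_of (a, x, b))" by (auto simp: rad_gens_def)
    show "y \<in> rad_part Q I M"
    proof (cases "a \<in> J")
      case True
      have F: "frag_of (\<one>\<^bsub>A\<^esub>, x, b) \<in> carrier F" using * by (simp add: frag_of_in_F)
      then have "y = a \<odot>\<^bsub>M\<^esub> cls (frag_of (\<one>\<^bsub>A\<^esub>, x, b))"
        using * by (simp add: smult_cls)
      then have "y \<in> ?G1" using True cls_closed[OF F] by blast
      then show ?thesis by (intro H1 generate.incl)
    next
      case False
      have F: "frag_of (a, x, \<one>\<^bsub>A\<^esub>) \<in> carrier F" using * by (simp add: frag_of_in_F)
      then have "y = rsmult M (cls (frag_of (a, x, \<one>\<^bsub>A\<^esub>))) b"
        using * by (simp add: rsmult_cls)
      then have "y \<in> ?G2" using False * cls_closed[OF F] by blast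
      then show ?thesis by (intro H2 generate.incl)
    qed
  qed
  then have "generate (add_monoid M) (cls ` rad_gens) \<subseteq> rad_part Q I M"
    using comm_group.mult_subgroups[OF M.a_comm_group H] unfolding rp
    by (rule group.generate_subgroup_incl[OF M.a_group])
  then show ?thesis
    unfolding Rad_def using cls.generate_img[OF rad_gens_subset] by simp
qed

lemma kspan_subset_Rad: "Y \<subseteq> Rad \<Longrightarrow> kspan Q I M Y \<subseteq> Rad"
  unfolding kspan_def
  by (rule group.generate_subgroup_incl[OF M.a_group _ Rad_subgroup])
    (auto intro!: Rad_smult proj_closed E_subset kq_const_in_E)

section \<open>Simple tensors and bimodule maps\<close>

lemma pure_tensor_in_Rad:
  "a \<in> carrier A \<Longrightarrow> x \<in> span_paths X \<Longrightarrow> b \<in> carrier A \<Longrightarrow> a \<in> J \<or> b \<in> J \<Longrightarrow>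
    pure_tensor Q I X a x b \<in> Rad"
  unfolding Rad_def pure_tensor_def by (intro imageI generate.incl) (auto simp: rad_gens_def)

lemma pure_tensor_closed:
  "a \<in> carrier A \<Longrightarrow> x \<in> span_paths X \<Longrightarrow> b \<in> carrier A \<Longrightarrow> pure_tensor Q I X a x b \<in> carrier M"
  unfolding pure_tensor_def by (rule cls_closed) (simp add: frag_of_in_F)

lemma rels_in_sub: "r \<in> tens_rels Q I X \<Longrightarrow> r \<in> tens_sub Q I X"
  unfolding tens_sub_def by (rule generate.incl)

lemma pure_tensor_balance_left:
  assumes "a \<in> carrier A" "e \<in> span_paths (paths_eq Q 0)" "x \<in> span_paths X" "b \<in> carrier A"
  shows "pure_tensor Q I X (a \<otimes>\<^bsub>A\<^esub> \<pi> e) x b = pure_tensor Q I X a (kq_mult e x) b"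
  unfolding pure_tensor_def
  by (rule cls_eqI) (use assms in \<open>auto simp: frag_of_in_F E_mult_left E_subset intro!: rels_in_sub rels_intros\<close>)

lemma pure_tensor_balance_right:
  assumes "a \<in> carrier A" "e \<in> span_paths (paths_eq Q 0)" "x \<in> span_paths X" "b \<in> carrier A"
  shows "pure_tensor Q I X a (kq_mult x e) b = pure_tensor Q I X a x (\<pi> e \<otimes>\<^bsub>A\<^esub> b)"
  unfolding pure_tensor_def
  by (rule cls_eqI) (use assms in \<open>auto simp: frag_of_in_F E_mult_right E_subset intro!: rels_in_sub rels_intros\<close>)

lemma pure_tensor_add_mid:
  assumes "a \<in> carrier A" "x \<in> span_paths X" "y \<in> span_paths X" "b \<in> carrier A"
  shows "pure_tensor Q I X a (x + y) b = pure_tensor Q I X a x b \<oplus>\<^bsub>M\<^esub> pure_tensor Q I X a y b"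
proof -
  have fr: "frag_of (a, x, b) \<in> carrier F" "frag_of (a, y, b) \<in> carrier F" "frag_of (a, x + y, b) \<in> carrier F"
    using assms by (auto simp: frag_of_in_F span_paths_add)
  have "frag_of (a, x + y, b) - (frag_of (a, x, b) + frag_of (a, y, b)) \<in> tens_sub Q I X"
    using rels_in_sub[OF rels_intros(2)[OF assms]] by (simp add: diff_diff_add)
  then have "cls (frag_of (a, x + y, b)) = cls (frag_of (a, x, b) + frag_of (a, y, b))"
    using fr F.m_closed[OF fr(1,2)] by (intro cls_eqI) auto
  then show ?thesis using fr by (simp add: pure_tensor_def cls_add)
qed

lemma pure_tensor_zero_mid:
  assumes "a \<in> carrier A" "b \<in> carrier A"
  shows "pure_tensor Q I X a 0 b = \<zero>\<^bsub>M\<^esub>"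
  using pure_tensor_add_mid[of a 0 0 b] pure_tensor_closed[of a 0 b] assms
    M.add.r_cancel_one'[of "pure_tensor Q I X a 0 b" "pure_tensor Q I X a 0 b"] by simp

text \<open>Writing \<open>c p\<close> as the product of the scalar in E with \<open>p\<close>,
  balancing moves the scalar into the left factor. Monomial tensors are thus obtained from
  \<open>1 \<otimes> p \<otimes> 1\<close> by the two actions.\<close>

lemma pure_tensor_scalar:
  assumes "a \<in> carrier A" "p \<in> X" "b \<in> carrier A"
  shows "pure_tensor Q I X a (pmono c p) b =
    rsmult M ((a \<otimes>\<^bsub>A\<^esub> \<pi> (kq_const Q c)) \<odot>\<^bsub>M\<^esub> pure_tensor Q I X \<one>\<^bsub>A\<^esub> (pmono1 p) \<one>\<^bsub>A\<^esub>) b"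
proof -
  have p: "p \<in> paths Q" using assms X_paths by blast
  let ?a = "a \<otimes>\<^bsub>A\<^esub> \<pi> (kq_const Q c)"
  have a: "?a \<in> carrier A" using assms by (simp add: E_subset kq_const_in_E)
  have x: "pmono1 p \<in> span_paths X" using assms by (simp add: pmono_in_span)
  have "pure_tensor Q I X a (pmono c p) b = pure_tensor Q I X a (kq_mult (kq_const Q c) (pmono1 p)) b"
    by (simp add: kq_const_left[OF wf_digraph_axioms finite_verts p])
  also have "\<dots> = pure_tensor Q I X ?a (pmono1 p) b"
    using pure_tensor_balance_left[OF assms(1) kq_const_in_E x assms(3)] by simp
  also have "\<dots> = rsmult M (?a \<odot>\<^bsub>M\<^esub> pure_tensor Q I X \<one>\<^bsub>A\<^esub> (pmono1 p) \<one>\<^bsub>A\<^esub>) b"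
  proof -
    have f: "frag_of (\<one>\<^bsub>A\<^esub>, pmono1 p, \<one>\<^bsub>A\<^esub>) \<in> carrier F" "frag_of (?a, pmono1 p, \<one>\<^bsub>A\<^esub>) \<in> carrier F"
      using a x by (simp_all only: frag_of_in_F mem_Sigma_iff A.one_closed)
    show ?thesis
      unfolding pure_tensor_def smult_cls[OF a f(1)] frag_extend_of prod.case A.r_one[OF a]
        rsmult_cls[OF assms(3) f(2)] A.l_one[OF assms(3)] ..
  qed
  finally show ?thesis .
qed

text \<open>Reduces a statement about a whole image to the elements
  \<open>1 \<otimes> q \<otimes> 1\<close>. The passage goes from monomial middle factors to finite
  sums of them, and from simple tensors to arbitrary classes by induction over the free abelian
  group.\<close>

lemma bimodule_hom_image:
  assumes d: "d \<in> bimodule_hom A M M'" and M': "abelian_group M'"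
    and B: "subgroup B (add_monoid M')"
    and B_smult: "\<And>a x. a \<in> carrier A \<Longrightarrow> x \<in> B \<Longrightarrow> a \<odot>\<^bsub>M'\<^esub> x \<in> B"
    and B_rsmult: "\<And>a x. a \<in> carrier A \<Longrightarrow> x \<in> B \<Longrightarrow> rsmult M' x a \<in> B"
    and gen: "\<And>q. q \<in> X \<Longrightarrow> d (pure_tensor Q I X \<one>\<^bsub>A\<^esub> (pmono1 q) \<one>\<^bsub>A\<^esub>) \<in> B"
  shows "d ` carrier M \<subseteq> B"
proof -
  interpret M': abelian_group M' by fact
  have dh: "d \<in> hom (add_monoid M) (add_monoid M')"
    using d by (auto simp: bimodule_hom_def hom_def)
  interpret d: group_hom "add_monoid M" "add_monoid M'" d
    using dh by (simp add: group_hom_def group_hom_axioms_def M.a_group M'.a_group)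
  interpret h: group_hom F "add_monoid M'" "d \<circ> cls"
    using hom_compose[OF cls.homh dh] by (simp add: group_hom_def group_hom_axioms_def M'.a_group)
  have sc: "d (pure_tensor Q I X a (pmono c p) b) \<in> B" if "a \<in> carrier A" "p \<in> X" "b \<in> carrier A" for a c p b
  proof -
    let ?t = "pure_tensor Q I X \<one>\<^bsub>A\<^esub> (pmono1 p) \<one>\<^bsub>A\<^esub>" and ?a = "a \<otimes>\<^bsub>A\<^esub> \<pi> (kq_const Q c)"
    have t: "?t \<in> carrier M" using that by (intro pure_tensor_closed) (simp_all add: pmono_in_span)
    have a: "?a \<in> carrier A" using that by (simp add: E_subset kq_const_in_E)
    have "d (pure_tensor Q I X a (pmono c p) b) = rsmult M' (?a \<odot>\<^bsub>M'\<^esub> d ?t) b"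
      unfolding pure_tensor_scalar[OF that]
      using d t a that smult_closed[OF a t] by (simp add: bimodule_hom_def)
    then show ?thesis using B_smult B_rsmult a that gen by simp
  qed
  have pt: "d (pure_tensor Q I X a x b) \<in> B" if a: "a \<in> carrier A" and x: "x \<in> span_paths X" and b: "b \<in> carrier A" for a x b
  proof -
    have "d (pure_tensor Q I X a (\<Sum>p\<in>P. pmono (Poly_Mapping.lookup x p) p) b) \<in> B"
      if "finite P" "P \<subseteq> X" for P
      using that
    proof (induction P rule: finite_induct)
      case empty
      show ?case
        using pure_tensor_zero_mid[OF a b] d.hom_one subgroup.one_closed[OF B] by simp
    next
      case (insert p P)
      let ?y = "\<Sum>p\<in>P. pmono (Poly_Mapping.lookup x p) p" and ?c = "pmono (Poly_Mapping.lookup x p) p"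
      have K: "?c \<in> span_paths X" "?y \<in> span_paths X"
        using insert.prems by (auto intro!: pmono_in_span span_paths_sum)
      have "pure_tensor Q I X a (?c + ?y) b = pure_tensor Q I X a ?c b \<oplus>\<^bsub>M\<^esub> pure_tensor Q I X a ?y b"
        by (rule pure_tensor_add_mid[OF a K b])
      then have "d (pure_tensor Q I X a (?c + ?y) b)
          = d (pure_tensor Q I X a ?c b) \<oplus>\<^bsub>M'\<^esub> d (pure_tensor Q I X a ?y b)"
        using d.hom_mult pure_tensor_closed[OF a K(1) b] pure_tensor_closed[OF a K(2) b] by simp
      moreover have "d (pure_tensor Q I X a ?c b) \<in> B" "d (pure_tensor Q I X a ?y b) \<in> B"
        using sc[OF a _ b] insert by auto
      ultimately show ?case
        using insert.hyps subgroup.m_closed[OF B] by simp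
    qed
    from this[of "Poly_Mapping.keys x"] x show ?thesis
      unfolding sum_pmono[of x, symmetric] by (simp add: span_paths_def)
  qed
  have "d (cls \<xi>) \<in> B" if "Poly_Mapping.keys \<xi> \<subseteq> S" for \<xi>
  proof (rule free_Abelian_group_induct[OF that])
    show "d (cls 0) \<in> B" using h.hom_one subgroup.one_closed[OF B] by simp
    show "d (cls (x - y)) \<in> B"
      if "Poly_Mapping.keys x \<subseteq> S" "Poly_Mapping.keys y \<subseteq> S" "d (cls x) \<in> B" "d (cls y) \<in> B" for x y
    proof -
      have c: "x \<in> carrier F" "y \<in> carrier F" using that by (simp_all add: carrier_F)
      have "d (cls (x - y)) = d (cls x) \<otimes>\<^bsub>add_monoid M'\<^esub> inv\<^bsub>add_monoid M'\<^esub> d (cls y)"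
        using h.hom_mult[OF c(1) F.inv_closed[OF c(2)]] h.hom_inv[OF c(2)] unfolding F_diff[OF c(2)] by simp
      then show ?thesis
        using that subgroup.m_closed[OF B] subgroup.m_inv_closed[OF B] by simp
    qed
    show "d (cls (frag_of g)) \<in> B" if "g \<in> S" for g
      using pt that by (cases g) (simp add: pure_tensor_def)
  qed
  then show ?thesis by (auto simp: carrier_M carrier_F)
qed

lemma Rad_minus: "x \<in> Rad \<Longrightarrow> y \<in> Rad \<Longrightarrow> x \<ominus>\<^bsub>M\<^esub> y \<in> Rad"
  using subgroup.m_closed[OF Rad_subgroup] subgroup.m_inv_closed[OF Rad_subgroup]
  by (simp add: a_minus_def a_inv_def)

lemma Rad_subset: "Rad \<subseteq> carrier M"
  using subgroup.subset[OF Rad_subgroup] by simp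

lemma Rad_zero: "\<zero>\<^bsub>M\<^esub> \<in> Rad"
  using subgroup.one_closed[OF Rad_subgroup] by simp

lemma Rad_minus_cancel:
  assumes "x \<in> carrier M" "y \<in> Rad" "x \<ominus>\<^bsub>M\<^esub> y \<in> Rad"
  shows "x \<in> Rad"
proof -
  have "x = (x \<ominus>\<^bsub>M\<^esub> y) \<oplus>\<^bsub>M\<^esub> y"
    using assms Rad_subset by (auto simp: a_minus_def M.a_assoc M.l_neg)
  then show ?thesis using subgroup.m_closed[OF Rad_subgroup assms(3,2)] by simp
qed

lemma finsum_in_Rad:
  assumes "\<And>i. i \<in> K \<Longrightarrow> f i \<in> Rad"
  shows "finsum M f K \<in> Rad"
  using assms
proof (induction K rule: infinite_finite_induct)
  case (insert i K)
  then have "f \<in> K \<rightarrow> carrier M" "f i \<in> carrier M" using Rad_subset by auto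
  then show ?case
    using insert subgroup.m_closed[OF Rad_subgroup, of "f i" "finsum M f K"] by simp
qed (simp_all add: Rad_zero M.finsum_infinite)

text \<open>Recovers membership of a representative from membership of a coset. Sums of cosets are
  formed elementwise, so \<open>\<xi> + \<zeta>\<close> lies in a coset contained in the carrier,
  and \<open>\<zeta>\<close> can be subtracted.\<close>

lemma cls_minus_carrierD:
  assumes "cls \<xi> \<ominus>\<^bsub>M\<^esub> y \<in> carrier M" "y \<in> carrier M"
  shows "\<xi> \<in> carrier F"
proof -
  have "\<ominus>\<^bsub>M\<^esub> y \<in> carrier M" using assms(2) by simp
  then obtain \<zeta> where z: "\<zeta> \<in> carrier F" "\<ominus>\<^bsub>M\<^esub> y = cls \<zeta>" by (auto simp: carrier_M)
  obtain \<eta> where e: "\<eta> \<in> carrier F" "cls \<xi> \<ominus>\<^bsub>M\<^esub> y = cls \<eta>" using assms(1) by (auto simp: carrier_M)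
  \<comment> \<open>Here \<open>\<rho>\<close> is arbitrary, possibly outside the carrier of
    \<open>F\<close>.\<close>
  have self: "\<rho> \<in> cls \<rho>" for \<rho>
    using sub.one_closed by (force simp: tens_class_def r_coset_def)
  have "cls \<xi> \<ominus>\<^bsub>M\<^esub> y = cls \<xi> <#>\<^bsub>F\<^esub> cls \<zeta>"
    by (simp add: a_minus_def z(2) M_simps(2))
  moreover have "\<xi> + \<zeta> \<in> cls \<xi> <#>\<^bsub>F\<^esub> cls \<zeta>"
    using self[of \<xi>] self[of \<zeta>] by (auto simp: set_mult_def)
  ultimately have "\<xi> + \<zeta> \<in> cls \<eta>" using e(2) by simp
  then have "\<xi> + \<zeta> \<in> carrier F"
    unfolding tens_class_def using F.r_coset_subset_G[OF sub.subset e(1)] by blast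
  then show ?thesis using diff_in_F[OF _ z(1), of "\<xi> + \<zeta>"] by simp
qed

lemma monomial_in_J: "p \<in> paths Q \<Longrightarrow> 1 \<le> plen p \<Longrightarrow> \<pi> (pmono c p) \<in> J"
  unfolding arrow_ideal_def by (intro imageI pmono_in_span) (simp add: paths_ge_iff)

lemma monomial_closed: "p \<in> paths Q \<Longrightarrow> \<pi> (pmono c p) \<in> carrier A"
  by (intro proj_closed pmono_in_span)

text \<open>If \<open>b\<close> and \<open>b'\<close> have no arrows, their multiples lie in E and
  can be moved across the tensor sign; the middle factor then becomes a product that is zero by the
  assumption \<open>c\<close>.\<close>

lemma monomial_tensor_in_Rad:
  assumes b: "b \<in> paths Q" "b' \<in> paths Q" and p: "p \<in> X"
    and c: "l = 0 \<or> \<not> linked b p \<or> \<not> linked p b' \<or> 1 \<le> plen b \<or> 1 \<le> plen b'"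
  shows "pure_tensor Q I X (\<pi> (pmono l b)) (pmono1 p) (\<pi> (pmono1 b')) \<in> Rad"
proof (cases "1 \<le> plen b \<or> 1 \<le> plen b'")
  case True
  then show ?thesis
    using b p by (intro pure_tensor_in_Rad) (auto intro: monomial_closed monomial_in_J pmono_in_span)
next
  case False
  then have e: "pmono m b \<in> span_paths (paths_eq Q 0)" "pmono m b' \<in> span_paths (paths_eq Q 0)" for m :: 'k
    using b by (auto intro!: pmono_in_span simp: paths_eq_def)
  have x: "pmono1 p \<in> span_paths X" using p by (rule pmono_in_span)
  have cl: "\<pi> (pmono l b) \<in> carrier A" "\<pi> (pmono1 b') \<in> carrier A" using b by (auto intro: monomial_closed)
  have "pure_tensor Q I X (\<pi> (pmono l b)) (pmono1 p) (\<pi> (pmono1 b')) = \<zero>\<^bsub>M\<^esub>"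
  proof (cases "l = 0 \<or> \<not> linked b p")
    case True
    then have "kq_mult (pmono l b) (pmono1 p :: ('v, 'a, 'k) kq) = 0" by (auto simp: kq_mult_pmono)
    then show ?thesis
      using pure_tensor_balance_left[OF A.one_closed e(1)[of l] x cl(2)] cl
        pure_tensor_zero_mid[OF A.one_closed cl(2)] by simp
  next
    case False
    then have "kq_mult (pmono1 p) (pmono1 b' :: ('v, 'a, 'k) kq) = 0"
      using c \<open>\<not> (1 \<le> plen b \<or> 1 \<le> plen b')\<close> by (auto simp: kq_mult_pmono)
    then show ?thesis
      using pure_tensor_balance_right[OF cl(1) e(2)[of 1] x A.one_closed] cl
        pure_tensor_zero_mid[OF cl(1) A.one_closed] by simp
  qed
  then show ?thesis using Rad_zero by simp
qed

end


section \<open>Minimality\<close>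

theorem theorem8p1:
  fixes Q :: "('v, 'a) pre_digraph"
    and I :: "('v, 'a, 'k::field) kq set"
    and R :: "('v, 'a, 'k) redsys"
    and N :: nat
    and \<delta>aug aug :: "('v, 'a, 'k) tens \<Rightarrow> ('v, 'a, 'k) kq set"
    and \<delta> d :: "nat \<Rightarrow> ('v, 'a, 'k) tens \<Rightarrow> ('v, 'a, 'k) tens"
  assumes quiver: "wf_digraph Q" "finite (verts Q)"
    and ideal: "ideal I (path_algebra Q)"
    and indep: "lin_indep_classes Q I (paths_eq Q 0 \<union> paths_eq Q 1)"
    and red: "reduction_system Q R" "diamond Q I R"
    and N: "N \<ge> 2"
    and homog: "\<And>s f. (s, f) \<in> R \<Longrightarrow> s \<in> paths_eq Q N \<and> f \<in> span_paths (paths_eq Q N)"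
    and len: "\<And>(n::nat) p q. p \<in> amb Q R (int n) \<Longrightarrow> q \<in> amb Q R (int n + 1) \<Longrightarrow> plen p < plen q"
    and \<delta>aug: "is_delta_aug Q I R \<delta>aug"
    and \<delta>: "\<And>n. is_delta Q I R n (\<delta> n)"
    and res: "is_resolution Q I R aug d"
    and aug: "\<And>x. x \<in> carrier (resP Q I R (-1)) \<Longrightarrow> aug x = \<delta>aug x"
    and d0: "\<And>x. x \<in> carrier (resP Q I R 0) \<Longrightarrow> d 0 x = \<delta> 0 x"
    and aug_d0: "\<And>x. x \<in> carrier (resP Q I R 0) \<Longrightarrow> aug (d 0 x) = \<zero>\<^bsub>quot_alg Q I\<^esub>"
    and dd: "\<And>n x. x \<in> carrier (resP Q I R (int n + 1)) \<Longrightarrow> d n (d (Suc n) x) = \<zero>\<^bsub>resP Q I R (int n - 1)\<^esub>"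
    and diff: "\<And>i q. i \<ge> 1 \<Longrightarrow> q \<in> amb Q R (int i) \<Longrightarrow>
        d i (one_tensor Q I R (int i) q) \<ominus>\<^bsub>resP Q I R (int i - 1)\<^esub> \<delta> i (one_tensor Q I R (int i) q)
        \<in> kspan Q I (resP Q I R (int i - 1)) (Lbar Q I R (int i - 1) (pmono1 q))"
  shows "minimal Q I R d"
  unfolding minimal_def
proof
  fix n
  interpret wf_digraph Q by fact
  have qt: "quiver_tensor Q I (amb Q R m)" for m
    using quiver ideal amb_subset_paths[OF red(1)]
    by (intro quiver_tensor.intro quiver_quotient.intro quiver_quotient_axioms.intro quiver_tensor_axioms.intro)
  interpret T: quiver_tensor Q I "amb Q R (int n)" by (rule qt)
  interpret T': quiver_tensor Q I "amb Q R (int n - 1)" by (rule qt)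
  note defs = resP_def pt_def one_tensor_def
  have hom: "plen s = N" if "s \<in> fst ` R" for s
    using that homog by (force simp: paths_eq_def)
  \<comment> \<open>The length hypothesis compares degrees from 0 on, so it is applied at
    \<open>n - 1\<close> with \<open>n \<ge> 1\<close>.\<close>
  have shorter: "plen p < plen q" if "n \<ge> 1" "p \<in> amb Q R (int n - 1)" "q \<in> amb Q R (int n)" for p q
    using len[of p "n - 1" q] that by (simp add: of_nat_diff)
  have dhom: "d n \<in> bimodule_hom T.A T.M T'.M"
    using res by (auto simp: is_resolution_def Let_def defs)
  have \<delta>hom: "\<delta> n \<in> bimodule_hom T.A T.M T'.M"
    using \<delta>[of n] by (auto simp: is_delta_def Let_def defs)
  have one: "one_tensor Q I R (int n) q \<in> carrier T.M" if "q \<in> amb Q R (int n)" for q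
    unfolding defs using that by (intro T.pure_tensor_closed pmono_in_span) auto
  have \<delta>_Rad: "\<delta> n (one_tensor Q I R (int n) q) \<in> T'.Rad" if q: "q \<in> amb Q R (int n)" for q
  proof -
    consider "n = 0" | "n \<ge> 2" "even n" | "odd n" by (metis One_nat_def Suc_1 Suc_leI even_zero odd_one not_gr0 le_neq_implies_less)
    then show ?thesis
    proof cases
      case 1
      have q': "q \<in> paths Q" "1 \<le> plen q" using q 1 by (auto simp: amb_def paths_eq_def)
      \<comment> \<open>In degree -1 the generators are the vertices, so the unit of E is an
        admissible middle factor.\<close>
      have E: "kq_const Q 1 \<in> (span_paths (amb Q R (int n - 1)) :: ('v, 'a, 'k) kq set)"
        using T.kq_const_in_E 1 by (simp add: amb_def)
      have "\<delta> n (one_tensor Q I R (int n) q) =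
          pure_tensor Q I (amb Q R (int n - 1)) (proj Q I (pmono1 q)) (kq_const Q 1) \<one>\<^bsub>T.A\<^esub> \<ominus>\<^bsub>T'.M\<^esub>
          pure_tensor Q I (amb Q R (int n - 1)) \<one>\<^bsub>T.A\<^esub> (kq_const Q 1) (proj Q I (pmono1 q))"
        using \<delta>[of n] q 1 by (simp add: is_delta_def Let_def defs)
      then show ?thesis
        using E q' by (simp add: T'.Rad_minus T'.pure_tensor_in_Rad T.monomial_in_J T.monomial_closed)
    next
      case 2
      then obtain us where us: "left_fact Q R n us q" using q by (auto simp: amb_def split: if_splits)
      obtain vs where vs: "right_fact Q R n vs q"
        using right_fact_exists[OF red(1) N hom us] 2 by auto
      let ?t1 = "pure_tensor Q I (amb Q R (int n - 1)) (proj Q I (pmono1 (vs ! n))) (pmono1 (pprod (rev (take n vs)))) \<one>\<^bsub>T.A\<^esub>"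
      let ?t2 = "pure_tensor Q I (amb Q R (int n - 1)) \<one>\<^bsub>T.A\<^esub> (pmono1 (pprod (take n us))) (proj Q I (pmono1 (us ! n)))"
      have eq: "\<delta> n (one_tensor Q I R (int n) q) = ?t1 \<ominus>\<^bsub>T'.M\<^esub> ?t2"
        using \<delta>[of n] q 2 us vs by (simp add: is_delta_def Let_def defs)
      have "pprod (take n us) \<in> amb Q R (int n - 1)"
        using left_fact_butlast_amb[OF red(1) N hom us] 2 by simp
      then have t2: "?t2 \<in> T'.Rad"
        using left_fact_last[OF us] 2
        by (intro T'.pure_tensor_in_Rad) (auto intro: T.monomial_in_J T.monomial_closed pmono_in_span)
      \<comment> \<open>Since \<open>\<delta> n\<close> takes values in the tensor product, the generator occurring in \<open>?t1\<close> is one of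
        its generators; so \<open>v\<^sub>n\<^sub>-\<^sub>1 \<dots> v\<^sub>0\<close> need not be shown to be an ambiguity separately.\<close>
      have "?t1 \<ominus>\<^bsub>T'.M\<^esub> ?t2 \<in> carrier T'.M"
        using \<delta>hom one[OF q] unfolding eq[symmetric] by (auto simp: bimodule_hom_def)
      then have "frag_of (proj Q I (pmono1 (vs ! n)), pmono1 (pprod (rev (take n vs))), \<one>\<^bsub>T.A\<^esub>) \<in> carrier T'.F"
        using t2 T'.Rad_subset by (intro T'.cls_minus_carrierD[of _ ?t2]) (auto simp: pure_tensor_def)
      then have "?t1 \<in> T'.Rad"
        using right_fact_last[OF vs] 2
        by (intro T'.pure_tensor_in_Rad) (auto simp: T'.frag_of_in_F intro: T.monomial_in_J)
      then show ?thesis unfolding eq using t2 by (rule T'.Rad_minus)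
    next
      case 3
      have "\<delta> n (one_tensor Q I R (int n) q) =
          finsum T'.M (\<lambda>(a, p, c). pure_tensor Q I (amb Q R (int n - 1)) (proj Q I (pmono1 a)) (pmono1 p) (proj Q I (pmono1 c)))
            {(a, p, c). a \<in> paths Q \<and> p \<in> amb Q R (int n - 1) \<and> c \<in> paths Q \<and>
               linked a p \<and> linked p c \<and> pcat (pcat a p) c = q}"
        using \<delta>[of n] q 3 by (simp add: is_delta_def Let_def defs)
      also have "\<dots> \<in> T'.Rad"
      proof (intro T'.finsum_in_Rad, clarify)
        fix a p c assume *: "a \<in> paths Q" "p \<in> amb Q R (int n - 1)" "c \<in> paths Q"
          "q = pcat (pcat a p) c"
        have "plen p < plen q" using shorter[OF _ *(2) q] 3 by (cases n) auto
        then have "1 \<le> plen a \<or> 1 \<le> plen c" by (auto simp: *(4))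
        then show "pure_tensor Q I (amb Q R (int n - 1)) (proj Q I (pmono1 a)) (pmono1 p) (proj Q I (pmono1 c)) \<in> T'.Rad"
          using * by (intro T'.monomial_tensor_in_Rad) auto
      qed
      finally show ?thesis .
    qed
  qed
  have Lbar: "Lbar Q I R (int n - 1) (pmono1 q) \<subseteq> T'.Rad" if n: "n \<ge> 1" and q: "q \<in> amb Q R (int n)" for q
  proof
    fix y assume "y \<in> Lbar Q I R (int n - 1) (pmono1 q)"
    then obtain l b p b' where y: "y = pure_tensor Q I (amb Q R (int n - 1)) (proj Q I (pmono l b)) (pmono1 p) (proj Q I (pmono1 b'))"
      and b: "b \<in> paths Q" "b' \<in> paths Q" and p: "p \<in> amb Q R (int n - 1)"
      and pr: "preceq Q R (kq_mult (kq_mult (pmono l b) (pmono1 p)) (pmono1 b')) (pmono1 q)"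
      by (auto simp: Lbar_def pt_def irr_paths_def prec_def)
    have R: "plen s = N \<and> f \<in> span_paths {p. plen p = N}" if "(s, f) \<in> R" for s f
      using homog[OF that] span_paths_mono[of "paths_eq Q N" "{p. plen p = N}"] by (auto simp: paths_eq_def)
    have "plen p < plen q" using shorter[OF n p q] .
    moreover have "kq_mult (kq_mult (pmono l b) (pmono1 p)) (pmono1 b') \<in> span_paths {p. plen p = plen q}"
      using preceq_homogeneous[OF R pr] by (simp add: pmono_homogeneous_iff)
    \<comment> \<open>The first three alternatives are the ways in which the product
      \<open>l b p b'\<close> can be zero.\<close>
    ultimately have "l = 0 \<or> \<not> linked b p \<or> \<not> linked p b' \<or> 1 \<le> plen b \<or> 1 \<le> plen b'"
      by (auto simp: kq_mult_pmono pmono_homogeneous_iff)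
    then show "y \<in> T'.Rad" unfolding y by (rule T'.monomial_tensor_in_Rad[OF b p])
  qed
  have d_Rad: "d n (one_tensor Q I R (int n) q) \<in> T'.Rad" if q: "q \<in> amb Q R (int n)" for q
  proof (cases "n = 0")
    case True
    then show ?thesis using d0[of "one_tensor Q I R 0 q"] one[OF q] \<delta>_Rad[OF q] by (simp add: resP_def)
  next
    case False
    have "d n (one_tensor Q I R (int n) q) \<ominus>\<^bsub>T'.M\<^esub> \<delta> n (one_tensor Q I R (int n) q) \<in> T'.Rad"
      using diff[of n q] False q T'.kspan_subset_Rad[OF Lbar[OF _ q]] by (auto simp: resP_def)
    moreover have "d n (one_tensor Q I R (int n) q) \<in> carrier T'.M"
      using dhom one[OF q] by (auto simp: bimodule_hom_def)
    ultimately show ?thesis using T'.Rad_minus_cancel \<delta>_Rad[OF q] by blast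
  qed
  have "d n ` carrier T.M \<subseteq> T'.Rad"
  proof (rule T.bimodule_hom_image[OF dhom T'.M.abelian_group_axioms T'.Rad_subgroup T'.Rad_smult T'.Rad_rsmult])
    show "d n (pure_tensor Q I (amb Q R (int n)) \<one>\<^bsub>T.A\<^esub> (pmono1 q) \<one>\<^bsub>T.A\<^esub>) \<in> T'.Rad"
      if "q \<in> amb Q R (int n)" for q
      using d_Rad[OF that] unfolding defs .
  qed
  then show "d n ` carrier (resP Q I R (int n)) \<subseteq> rad_part Q I (resP Q I R (int n - 1))"
    using T'.Rad_subset_rad_part by (auto simp: resP_def)
qed

end
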